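(* Let $G$ be a Coxeter group with Coxeter generating set $\{g_1,\dots,g_n\}$, and let $T=\{1_G,g_1,\dots,g_n\}$. Let $G'$ be a group, and let $T'=\{1_{G'},g_1',\dots,g_n'\}$ be a generating set for $G'$. Then: (1) If $D(T)\supseteq D(T')$ as subsets of $\mathbb{C}\mathbb{P}^n$, then there is an epimorphism of groups $f:G\to G'$ such that $f(g_i)=g_i'$ for each $1\le i\le n$. In particular, if $G$ is finite then so is $G'$. (2) If $G$ is finite and $D(T)=D(T')$ as subschemes of $\mathbb{C}\mathbb{P}^n$, then the homomorphism $f$ from (1) is an isomorphism.
   Context: A Coxeter group with Coxeter generating set $\{g_1,\dots,g_n\}$ is a group presented by generators $g_1,\dots,g_n$ and relations $(g_ig_j)^{m_{ij}}=1$, where $m_{ii}=1$, $m_{ij}=m_{ji}\in\mathbb{N}\cup\{\infty\}$ and $m_{ij}\ge 2$ for $i\ne j$ (no relation is imposed when $m_{ij}=\infty$). For a group $G$, let $\mathbb{C}[G]^\vee$ be the Hilbert space completion of the group ring $\mathbb{C}[G]$ with respect to the inner product $\langle\sum a_g g,\sum b_g g\rangle=\sum a_g\overline{b_g}$ (so $\mathbb{C}[G]^\vee=\mathbb{C}[G]$ when $G$ is finite). The left regular representation $\lambda: G\to GL(\mathbb{C}[G]^\vee)$ is induced by left multiplication. For bounded linear operators $A_0,\dots,A_n$ on a Hilbert space $V$, the projective joint spectrum is $$\sigma(A_0,\dots,A_n)=\{[x_0:\dots:x_n]\in\mathbb{C}\mathbb{P}^n : x_0A_0+\dots+x_nA_n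 \text{ is not invertible}\}.$$ When $V$ is finite dimensional, $\sigma(A_0,\dots,A_n)$ is also regarded as the closed subscheme of $\mathbb{C}\mathbb{P}^n$ defined by the homogeneous polynomial $\det(x_0A_0+\dots+x_nA_n)$; thus two such hypersurfaces are equal as subschemes iff their defining polynomials agree up to a nonzero scalar. For a generating set $T=\{t_0,\dots,t_n\}$ of a group $G$, written in the given order, $D(T)=\sigma(\lambda(t_0),\dots,\lambda(t_n))$, where $\lambda$ is the left regular representation of $G$. Here the coordinate $x_0$ corresponds to the identity element and $x_i$ to $g_i$ (resp. $g_i'$). *)

theory Defs
  imports
    "HOL-Analysis.Infinite_Sum"
    "HOL-Algebra.Elementary_Groups"
    "HOL-Algebra.Generated_Groups"
    "HOL-Combinatorics.Permutations"
    "HOL-Library.Extended_Nat"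
    "HOL-Library.Poly_Mapping"
begin

section \<open>Group presentations and Coxeter groups\<close>

text \<open>A word over the letters indexed by \<open>I\<close>: the pair \<open>(i, True)\<close> stands for the \<open>i\<close>-th
  generator and \<open>(i, False)\<close> for its inverse.\<close>

type_synonym gword = "(nat \<times> bool) list"

definition gwords :: "nat set \<Rightarrow> gword set" where
  "gwords I = {w. fst ` set w \<subseteq> I}"

primrec word_eval :: "('a, 'c) monoid_scheme \<Rightarrow> (nat \<Rightarrow> 'a) \<Rightarrow> gword \<Rightarrow> 'a" where
  "word_eval G g [] = \<one>\<^bsub>G\<^esub>"
| "word_eval G g (s # w) =
     (if snd s then g (fst s) else inv\<^bsub>G\<^esub> (g (fst s))) \<otimes>\<^bsub>G\<^esub> word_eval G g w"

text \<open>The congruence on words whose quotient is the group presented by the generators \<open>I\<close> and the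
  relators \<open>R\<close>: it is generated by free cancellation and by deletion of relators. The class of the
  empty word is the normal closure of \<open>R\<close> in the free group on \<open>I\<close>.\<close>

inductive pres_eq :: "nat set \<Rightarrow> gword set \<Rightarrow> gword \<Rightarrow> gword \<Rightarrow> bool" for I R where
  refl: "w \<in> gwords I \<Longrightarrow> pres_eq I R w w"
| sym: "pres_eq I R u v \<Longrightarrow> pres_eq I R v u"
| trans: "pres_eq I R u v \<Longrightarrow> pres_eq I R v w \<Longrightarrow> pres_eq I R u w"
| cancel: "u \<in> gwords I \<Longrightarrow> v \<in> gwords I \<Longrightarrow> i \<in> I \<Longrightarrow>
    pres_eq I R (u @ [(i, b), (i, \<not> b)] @ v) (u @ v)"
| relator: "u \<in> gwords I \<Longrightarrow> v \<in> gwords I \<Longrightarrow> r \<in> R \<Longrightarrow> r \<in> gwords I \<Longrightarrow>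
    pres_eq I R (u @ r @ v) (u @ v)"

definition presented_by ::
  "('a, 'c) monoid_scheme \<Rightarrow> nat set \<Rightarrow> (nat \<Rightarrow> 'a) \<Rightarrow> gword set \<Rightarrow> bool" where
  "presented_by G I g R \<longleftrightarrow>
     group G \<and> g ` I \<subseteq> carrier G \<and> generate G (g ` I) = carrier G \<and>
     (\<forall>u\<in>gwords I. \<forall>v\<in>gwords I. word_eval G g u = word_eval G g v \<longleftrightarrow> pres_eq I R u v)"

definition coxeter_matrix :: "nat \<Rightarrow> (nat \<Rightarrow> nat \<Rightarrow> enat) \<Rightarrow> bool" where
  "coxeter_matrix n m \<longleftrightarrow>
     (\<forall>i\<in>{1..n}. m i i = 1) \<and>
     (\<forall>i\<in>{1..n}. \<forall>j\<in>{1..n}. m i j = m j i) \<and>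
     (\<forall>i\<in>{1..n}. \<forall>j\<in>{1..n}. i \<noteq> j \<longrightarrow> 2 \<le> m i j)"

text \<open>The relators \<open>(g\<^sub>i g\<^sub>j)\<^bsup>m i j\<^esup>\<close>, with none for \<open>m i j = \<infinity>\<close>.\<close>

definition coxeter_relators :: "nat \<Rightarrow> (nat \<Rightarrow> nat \<Rightarrow> enat) \<Rightarrow> gword set" where
  "coxeter_relators n m =
     {concat (replicate k [(i, True), (j, True)]) | i j k.
        i \<in> {1..n} \<and> j \<in> {1..n} \<and> m i j = enat k}"

definition coxeter_group :: "('a, 'c) monoid_scheme \<Rightarrow> nat \<Rightarrow> (nat \<Rightarrow> 'a) \<Rightarrow> bool" where
  "coxeter_group G n g \<longleftrightarrow>
     (\<exists>m. coxeter_matrix n m \<and> presented_by G {1..n} g (coxeter_relators n m))"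


section \<open>The Hilbert space with orthonormal basis \<open>I\<close>\<close>

text \<open>\<open>ell2 (carrier G)\<close> is the completion of the group ring: the group ring is the subspace of the
  finitely supported functions, which is dense by \<open>ell2_dense\<close> below, and \<open>ell2 I\<close> is complete by
  \<open>ell2_complete\<close>. The norm is the one induced by \<open>\<langle>u, v\<rangle> = \<Sum>x. u x * cnj (v x)\<close>.\<close>

definition ell2 :: "'a set \<Rightarrow> ('a \<Rightarrow> complex) set" where
  "ell2 I = {v. (\<forall>x. x \<notin> I \<longrightarrow> v x = 0) \<and> (\<lambda>x. (cmod (v x))\<^sup>2) summable_on I}"

definition ell2_norm :: "'a set \<Rightarrow> ('a \<Rightarrow> complex) \<Rightarrow> real" where
  "ell2_norm I v = sqrt (\<Sum>\<^sub>\<infinity>x\<in>I. (cmod (v x))\<^sup>2)"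

definition bounded_operator :: "'a set \<Rightarrow> (('a \<Rightarrow> complex) \<Rightarrow> 'a \<Rightarrow> complex) \<Rightarrow> bool" where
  "bounded_operator I A \<longleftrightarrow>
     (\<forall>v\<in>ell2 I. A v \<in> ell2 I) \<and>
     (\<forall>u\<in>ell2 I. \<forall>v\<in>ell2 I. A (\<lambda>x. u x + v x) = (\<lambda>x. A u x + A v x)) \<and>
     (\<forall>c. \<forall>v\<in>ell2 I. A (\<lambda>x. c * v x) = (\<lambda>x. c * A v x)) \<and>
     (\<exists>K. \<forall>v\<in>ell2 I. ell2_norm I (A v) \<le> K * ell2_norm I v)"

definition invertible_operator :: "'a set \<Rightarrow> (('a \<Rightarrow> complex) \<Rightarrow> 'a \<Rightarrow> complex) \<Rightarrow> bool" where
  "invertible_operator I A \<longleftrightarrow>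
     bounded_operator I A \<and>
     (\<exists>B. bounded_operator I B \<and> (\<forall>v\<in>ell2 I. A (B v) = v \<and> B (A v) = v))"

definition basis_vec :: "'a \<Rightarrow> 'a \<Rightarrow> complex" where
  "basis_vec h = (\<lambda>x. if x = h then 1 else 0)"

text \<open>The value at \<open>x\<close> of \<open>\<lambda>(g) (\<Sum>h. v h \<cdot> h) = \<Sum>h. v h \<cdot> g h\<close> is \<open>v (g\<^sup>-\<^sup>1 x)\<close>.\<close>

definition left_regular ::
  "('a, 'c) monoid_scheme \<Rightarrow> 'a \<Rightarrow> ('a \<Rightarrow> complex) \<Rightarrow> 'a \<Rightarrow> complex" where
  "left_regular G g v = (\<lambda>x. if x \<in> carrier G then v (inv\<^bsub>G\<^esub> g \<otimes>\<^bsub>G\<^esub> x) else 0)"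


section \<open>The projective joint spectrum\<close>

text \<open>A point of complex projective \<open>n\<close>-space is the set of all nonzero multiples of a nonzero
  vector \<open>(x\<^sub>0, \<dots>, x\<^sub>n)\<close>; such vectors are functions on the naturals that vanish beyond \<open>n\<close>.\<close>

definition hom_coords :: "nat \<Rightarrow> (nat \<Rightarrow> complex) set" where
  "hom_coords n = {x. (\<forall>i>n. x i = 0) \<and> (\<exists>i\<le>n. x i \<noteq> 0)}"

definition proj_point :: "(nat \<Rightarrow> complex) \<Rightarrow> (nat \<Rightarrow> complex) set" where
  "proj_point x = {y. \<exists>c. c \<noteq> 0 \<and> y = (\<lambda>i. c * x i)}"

definition lin_comb_op ::
  "nat \<Rightarrow> (nat \<Rightarrow> ('a \<Rightarrow> complex) \<Rightarrow> 'a \<Rightarrow> complex) \<Rightarrow> (nat \<Rightarrow> complex) \<Rightarrow>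
     ('a \<Rightarrow> complex) \<Rightarrow> 'a \<Rightarrow> complex" where
  "lin_comb_op n A x = (\<lambda>v y. \<Sum>i\<le>n. x i * A i v y)"

definition proj_joint_spectrum ::
  "'a set \<Rightarrow> nat \<Rightarrow> (nat \<Rightarrow> ('a \<Rightarrow> complex) \<Rightarrow> 'a \<Rightarrow> complex) \<Rightarrow> (nat \<Rightarrow> complex) set set" where
  "proj_joint_spectrum I n A =
     {proj_point x | x. x \<in> hom_coords n \<and> \<not> invertible_operator I (lin_comb_op n A x)}"

text \<open>The polynomial \<open>det (X\<^sub>0 A\<^sub>0 + \<dots> + X\<^sub>n A\<^sub>n)\<close> for finite \<open>I\<close>, as an element of the polynomial
  ring over the complex numbers in indeterminates \<open>X\<^sub>i\<close>: the \<open>(a, b)\<close> entry of \<open>A\<^sub>i\<close> in the basis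
  \<open>I\<close> is the \<open>a\<close>-coordinate of \<open>A\<^sub>i b\<close>.\<close>

type_synonym cpoly = "(nat \<Rightarrow>\<^sub>0 nat) \<Rightarrow>\<^sub>0 complex"

definition poly_const :: "complex \<Rightarrow> cpoly" where
  "poly_const c = Poly_Mapping.single 0 c"

definition poly_var :: "nat \<Rightarrow> cpoly" where
  "poly_var i = Poly_Mapping.single (Poly_Mapping.single i 1) 1"

definition det_on :: "'a set \<Rightarrow> ('a \<Rightarrow> 'a \<Rightarrow> 'r::comm_ring_1) \<Rightarrow> 'r" where
  "det_on I M = (\<Sum>p\<in>{p. p permutes I}. of_int (sign p) * (\<Prod>a\<in>I. M a (p a)))"

definition joint_spectrum_poly ::
  "'a set \<Rightarrow> nat \<Rightarrow> (nat \<Rightarrow> ('a \<Rightarrow> complex) \<Rightarrow> 'a \<Rightarrow> complex) \<Rightarrow> cpoly" where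
  "joint_spectrum_poly I n A =
     det_on I (\<lambda>a b. \<Sum>i\<le>n. poly_const (A i (basis_vec b) a) * poly_var i)"

definition with_one :: "('a, 'c) monoid_scheme \<Rightarrow> (nat \<Rightarrow> 'a) \<Rightarrow> nat \<Rightarrow> 'a" where
  "with_one G g = (\<lambda>i. if i = 0 then \<one>\<^bsub>G\<^esub> else g i)"

definition D :: "('a, 'c) monoid_scheme \<Rightarrow> nat \<Rightarrow> (nat \<Rightarrow> 'a) \<Rightarrow> (nat \<Rightarrow> complex) set set" where
  "D G n t = proj_joint_spectrum (carrier G) n (\<lambda>i. left_regular G (t i))"

definition D_poly :: "('a, 'c) monoid_scheme \<Rightarrow> nat \<Rightarrow> (nat \<Rightarrow> 'a) \<Rightarrow> cpoly" where
  "D_poly G n t = joint_spectrum_poly (carrier G) n (\<lambda>i. left_regular G (t i))"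

text \<open>Equality of \<open>D(T)\<close> and \<open>D(T')\<close> as subschemes. The scheme structure exists only when the Hilbert
  spaces are finite dimensional, hence the two finiteness conditions.\<close>

definition D_eq_as_subschemes ::
  "('a, 'c) monoid_scheme \<Rightarrow> (nat \<Rightarrow> 'a) \<Rightarrow> ('b, 'd) monoid_scheme \<Rightarrow> (nat \<Rightarrow> 'b) \<Rightarrow> nat \<Rightarrow> bool"
where
  "D_eq_as_subschemes G t G' t' n \<longleftrightarrow>
     finite (carrier G) \<and> finite (carrier G') \<and>
     (\<exists>c. c \<noteq> 0 \<and> D_poly G' n t' = poly_const c * D_poly G n t)"


section \<open>Sanity checks\<close>

lemma ell2_bounded_sums:
  assumes "\<And>x. x \<notin> I \<Longrightarrow> v x = 0"
    and "\<And>F. finite F \<Longrightarrow> F \<subseteq> I \<Longrightarrow> (\<Sum>x\<in>F. (cmod (v x))\<^sup>2) \<le> b\<^sup>2" and "0 \<le> b"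
  shows "v \<in> ell2 I" and "ell2_norm I v \<le> b"
proof -
  have s: "(\<lambda>x. (cmod (v x))\<^sup>2) summable_on I"
    by (rule nonneg_bdd_above_summable_on) (auto intro!: bdd_aboveI2[where M = "b\<^sup>2"] assms(2))
  then show "v \<in> ell2 I" using assms(1) by (simp add: ell2_def)
  have "(\<Sum>\<^sub>\<infinity>x\<in>I. (cmod (v x))\<^sup>2) \<le> b\<^sup>2"
    by (rule infsum_le_finite_sums[OF s assms(2)])
  then show "ell2_norm I v \<le> b"
    unfolding ell2_norm_def using assms(3) by (metis real_sqrt_le_mono real_sqrt_unique)
qed

lemma ell2_finite_sum_le:
  assumes "v \<in> ell2 I" "finite F" "F \<subseteq> I"
  shows "(\<Sum>x\<in>F. (cmod (v x))\<^sup>2) \<le> (ell2_norm I v)\<^sup>2"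
proof -
  have "0 \<le> (\<Sum>\<^sub>\<infinity>x\<in>I. (cmod (v x))\<^sup>2)" by (rule infsum_nonneg) simp
  then show ?thesis
    using assms finite_sum_le_infsum[of "\<lambda>x. (cmod (v x))\<^sup>2" I F]
    by (simp add: ell2_def ell2_norm_def)
qed

lemma ell2_diff:
  assumes "u \<in> ell2 I" "v \<in> ell2 I"
  shows "(\<lambda>x. u x - v x) \<in> ell2 I"
proof -
  have *: "(cmod (u x - v x))\<^sup>2 \<le> 2 * (cmod (u x))\<^sup>2 + 2 * (cmod (v x))\<^sup>2" for x
  proof -
    have "(cmod (u x - v x))\<^sup>2 \<le> (cmod (u x) + cmod (v x))\<^sup>2"
      by (intro power_mono norm_triangle_ineq4) simp
    also have "\<dots> \<le> 2 * (cmod (u x))\<^sup>2 + 2 * (cmod (v x))\<^sup>2"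
      using sum_squares_bound[of "cmod (u x)" "cmod (v x)"] by (simp add: power2_sum)
    finally show ?thesis .
  qed
  have "(\<lambda>x. 2 * (cmod (u x))\<^sup>2 + 2 * (cmod (v x))\<^sup>2) summable_on I"
    using assms by (intro summable_on_add summable_on_cmult_right) (auto simp: ell2_def)
  then have "(\<lambda>x. (cmod (u x - v x))\<^sup>2) summable_on I"
    by (rule summable_on_comparison_test) (use * in auto)
  then show ?thesis using assms by (simp add: ell2_def)
qed

lemma ell2_complete:
  assumes v: "\<And>k. v k \<in> ell2 I"
    and cauchy: "\<And>e. e > 0 \<Longrightarrow>
      \<exists>N. \<forall>k\<ge>N. \<forall>l\<ge>N. ell2_norm I (\<lambda>x. v k x - v l x) \<le> e"
  shows "\<exists>w\<in>ell2 I. (\<lambda>k. ell2_norm I (\<lambda>x. v k x - w x)) \<longlonglongrightarrow> 0"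
proof -
  have pt: "cmod (v k x - v l x) \<le> ell2_norm I (\<lambda>x. v k x - v l x)" for k l x
  proof (cases "x \<in> I")
    case True
    have nn: "0 \<le> ell2_norm I (\<lambda>x. v k x - v l x)"
      unfolding ell2_norm_def by (simp add: infsum_nonneg)
    from True have "(cmod (v k x - v l x))\<^sup>2 \<le> (ell2_norm I (\<lambda>x. v k x - v l x))\<^sup>2"
      using ell2_finite_sum_le[OF ell2_diff[OF v[of k] v[of l]], of "{x}"] by simp
    then show ?thesis using nn by (rule power2_le_imp_le)
  next
    case False
    then have "v k x - v l x = 0" using v by (simp add: ell2_def)
    then show ?thesis by (simp add: ell2_norm_def infsum_nonneg)
  qed
  have "Cauchy (\<lambda>k. v k x)" for x
  proof (rule metric_CauchyI)
    fix e :: real assume e: "0 < e"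
    then obtain N where N: "\<forall>k\<ge>N. \<forall>l\<ge>N. ell2_norm I (\<lambda>x. v k x - v l x) \<le> e / 2"
      using cauchy[of "e / 2"] by auto
    have "dist (v k x) (v l x) < e" if "k \<ge> N" "l \<ge> N" for k l
    proof -
      have "ell2_norm I (\<lambda>x. v k x - v l x) \<le> e / 2" using N that by blast
      then show ?thesis using pt[of k x l] e by (simp add: dist_norm)
    qed
    then show "\<exists>M. \<forall>m\<ge>M. \<forall>n\<ge>M. dist (v m x) (v n x) < e" by blast
  qed
  then have "\<exists>y. (\<lambda>k. v k x) \<longlonglongrightarrow> y" for x
    by (simp add: Cauchy_convergent_iff convergent_def)
  then obtain w where w: "\<And>x. (\<lambda>k. v k x) \<longlonglongrightarrow> w x" by metis
  have w0: "w x = 0" if "x \<notin> I" for x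
  proof -
    have "(\<lambda>k. v k x) = (\<lambda>k. 0)" using v that by (auto simp: ell2_def)
    then show ?thesis using w[of x] by (simp add: LIMSEQ_const_iff)
  qed
  have tail: "\<exists>N. \<forall>k\<ge>N. (\<lambda>x. v k x - w x) \<in> ell2 I \<and> ell2_norm I (\<lambda>x. v k x - w x) \<le> e"
    if e: "e > 0" for e
  proof -
    obtain N where N: "\<forall>k\<ge>N. \<forall>l\<ge>N. ell2_norm I (\<lambda>x. v k x - v l x) \<le> e"
      using cauchy[OF e] by blast
    have b: "(\<Sum>x\<in>F. (cmod (v k x - w x))\<^sup>2) \<le> e\<^sup>2" if k: "k \<ge> N" and F: "finite F" "F \<subseteq> I" for k F
    proof (rule LIMSEQ_le_const2)
      show "(\<lambda>l. \<Sum>x\<in>F. (cmod (v k x - v l x))\<^sup>2) \<longlonglongrightarrow> (\<Sum>x\<in>F. (cmod (v k x - w x))\<^sup>2)"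
        by (intro tendsto_intros w)
      have "(\<Sum>x\<in>F. (cmod (v k x - v l x))\<^sup>2) \<le> e\<^sup>2" if "l \<ge> N" for l
      proof -
        have "(\<Sum>x\<in>F. (cmod (v k x - v l x))\<^sup>2) \<le> (ell2_norm I (\<lambda>x. v k x - v l x))\<^sup>2"
          by (rule ell2_finite_sum_le[OF ell2_diff[OF v v] F])
        also have "\<dots> \<le> e\<^sup>2"
          using N k that by (intro power_mono) (auto simp: ell2_norm_def infsum_nonneg)
        finally show ?thesis .
      qed
      then show "\<exists>N. \<forall>l\<ge>N. (\<Sum>x\<in>F. (cmod (v k x - v l x))\<^sup>2) \<le> e\<^sup>2" by blast
    qed
    have "(\<lambda>x. v k x - w x) \<in> ell2 I \<and> ell2_norm I (\<lambda>x. v k x - w x) \<le> e" if "k \<ge> N" for k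
      using ell2_bounded_sums[of I "\<lambda>x. v k x - w x" e] b[OF that] w0 v[of k] e
      by (auto simp: ell2_def)
    then show ?thesis by blast
  qed
  obtain N where "(\<lambda>x. v N x - w x) \<in> ell2 I" using tail[of 1] by auto
  from ell2_diff[OF v[of N] this] have "w \<in> ell2 I" by simp
  moreover have "(\<lambda>k. ell2_norm I (\<lambda>x. v k x - w x)) \<longlonglongrightarrow> 0"
  proof (rule LIMSEQ_I)
    fix r :: real assume r: "0 < r"
    then obtain N where "\<forall>k\<ge>N. ell2_norm I (\<lambda>x. v k x - w x) \<le> r / 2"
      using tail[of "r / 2"] by auto
    moreover have "0 \<le> ell2_norm I (\<lambda>x. v k x - w x)" for k
      by (simp add: ell2_norm_def infsum_nonneg)
    ultimately show "\<exists>no. \<forall>n\<ge>no. norm (ell2_norm I (\<lambda>x. v n x - w x) - 0) < r"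
      using r by (intro exI[of _ N]) (auto intro: order_le_less_trans)
  qed
  ultimately show ?thesis by blast
qed

lemma ell2_dense:
  assumes v: "v \<in> ell2 I" and e: "e > 0"
  shows "\<exists>w\<in>ell2 I. finite {x. w x \<noteq> 0} \<and> ell2_norm I (\<lambda>x. v x - w x) \<le> e"
proof -
  let ?f = "\<lambda>x. (cmod (v x))\<^sup>2"
  have s: "?f summable_on I" using v by (simp add: ell2_def)
  obtain F where F: "finite F" "F \<subseteq> I" and d: "dist (sum ?f F) (infsum ?f I) \<le> e\<^sup>2"
    using infsum_finite_approximation[OF s, of "e\<^sup>2"] e by auto
  define w where "w = (\<lambda>x. if x \<in> F then v x else 0)"
  have w: "w \<in> ell2 I"
  proof -
    have "(\<Sum>x\<in>A. (cmod (w x))\<^sup>2) \<le> (ell2_norm I v)\<^sup>2" if "finite A" "A \<subseteq> I" for A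
    proof -
      have "(\<Sum>x\<in>A. (cmod (w x))\<^sup>2) \<le> (\<Sum>x\<in>A. ?f x)" by (intro sum_mono) (simp add: w_def)
      then show ?thesis using ell2_finite_sum_le[OF v that] by linarith
    qed
    then show ?thesis
      using F v by (intro ell2_bounded_sums(1)[of I w "ell2_norm I v"])
        (auto simp: w_def ell2_def ell2_norm_def infsum_nonneg)
  qed
  have "ell2_norm I (\<lambda>x. v x - w x) \<le> e"
  proof (rule ell2_bounded_sums(2))
    show "v x - w x = 0" if "x \<notin> I" for x using that v by (simp add: w_def ell2_def)
    show "0 \<le> e" using e by simp
    fix A assume A: "finite A" "A \<subseteq> I"
    have "(\<Sum>x\<in>A. (cmod (v x - w x))\<^sup>2) = (\<Sum>x\<in>A - F. ?f x)"
      using A by (intro sum.mono_neutral_cong_right) (auto simp: w_def)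
    also have "\<dots> = (\<Sum>x\<in>A \<union> F. ?f x) - sum ?f F"
    proof -
      have "sum ?f (A \<union> F) = sum ?f (A - F) + sum ?f F"
        using A F sum.union_disjoint[of "A - F" F ?f] by (simp add: Diff_Int_distrib2)
      then show ?thesis by simp
    qed
    also have "\<dots> \<le> infsum ?f I - sum ?f F"
      using A F finite_sum_le_infsum[OF s, of "A \<union> F"] by simp
    also have "\<dots> \<le> e\<^sup>2" using d by (simp add: dist_real_def)
    finally show "(\<Sum>x\<in>A. (cmod (v x - w x))\<^sup>2) \<le> e\<^sup>2" .
  qed
  moreover have "finite {x. w x \<noteq> 0}"
    by (rule finite_subset[OF _ F(1)]) (auto simp: w_def)
  ultimately show ?thesis using w by blast
qed

lemma left_regular_basis_vec:
  assumes "group G" "g \<in> carrier G" "h \<in> carrier G"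
  shows "left_regular G g (basis_vec h) = basis_vec (g \<otimes>\<^bsub>G\<^esub> h)"
proof -
  interpret group G by fact
  show ?thesis
    using assms(2,3) by (auto simp: left_regular_def basis_vec_def fun_eq_iff inv_solve_left')
qed

lemma left_regular_isometry:
  assumes "group G" "g \<in> carrier G" "v \<in> ell2 (carrier G)"
  shows "left_regular G g v \<in> ell2 (carrier G)"
    and "ell2_norm (carrier G) (left_regular G g v) = ell2_norm (carrier G) v"
proof -
  interpret group G by fact
  have bij: "bij_betw (\<lambda>x. inv\<^bsub>G\<^esub> g \<otimes>\<^bsub>G\<^esub> x) (carrier G) (carrier G)"
    using assms(2)
    by (intro bij_betw_byWitness[where f' = "\<lambda>x. g \<otimes>\<^bsub>G\<^esub> x"]) (auto simp: m_assoc[symmetric])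
  have "(\<lambda>x. (cmod (v (inv\<^bsub>G\<^esub> g \<otimes>\<^bsub>G\<^esub> x)))\<^sup>2) summable_on carrier G"
    using summable_on_reindex_bij_betw[OF bij, of "\<lambda>x. (cmod (v x))\<^sup>2"] assms(3)
    by (simp add: ell2_def)
  then show "left_regular G g v \<in> ell2 (carrier G)"
    by (auto simp: ell2_def left_regular_def cong: summable_on_cong)
  show "ell2_norm (carrier G) (left_regular G g v) = ell2_norm (carrier G) v"
    using infsum_reindex_bij_betw[OF bij, of "\<lambda>x. (cmod (v x))\<^sup>2"]
    by (auto simp: ell2_norm_def left_regular_def cong: infsum_cong)
qed

lemma bounded_operator_left_regular:
  assumes "group G" "g \<in> carrier G"
  shows "bounded_operator (carrier G) (left_regular G g)"
  unfolding bounded_operator_def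
  using left_regular_isometry[OF assms]
  by (auto simp: left_regular_def fun_eq_iff intro!: exI[of _ 1])

end

theory Submission
  imports
    Defs
    "HOL-Algebra.Multiplicative_Group"
    "Jordan_Normal_Form.Determinant"
begin

text \<open>
  On the coordinate line spanned by \<open>1\<close> and \<open>g\<^sub>i\<close>, \<open>D(T)\<close> meets only the points given by
  square roots of unity, whereas \<open>\<lambda>(h) - \<zeta>\<close> fails to be surjective for every \<open>\<zeta>\<close> of modulus one with
  \<open>\<zeta>\<^bsup>ord h\<^esup> = 1\<close> (all of the unit circle if \<open>h\<close> has infinite order); so \<open>D(T') \<subseteq> D(T)\<close>
  makes \<open>g\<^sub>i'\<close> an involution. For involutions \<open>a, b\<close> with product \<open>r\<close> and \<open>c\<^sup>2 = 2 + \<zeta> + \<zeta>\<^sup>-\<^sup>1\<close>, one has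
  \<open>(c + a + b) (a + b - c) = r\<^sup>-\<^sup>1 (r - \<zeta>) (r - \<zeta>\<^sup>-\<^sup>1)\<close>. Hence, if \<open>\<zeta>\<close> is in the spectrum of \<open>g\<^sub>i' g\<^sub>j'\<close>,
  one of the points \<open>\<plusminus>c\<close> on the line \<open>x\<^sub>i = x\<^sub>j = 1\<close> is in \<open>D(T')\<close>, and such a point is in \<open>D(T)\<close> only if
  \<open>\<zeta>\<^bsup>m\<^esup> = 1\<close> for \<open>m = m\<^sub>i\<^sub>j\<close>. So the Coxeter relations hold in \<open>G'\<close>. In the finite case the
  defining polynomials determine the spectra, and their degrees are the group orders, so the
  epimorphism is bijective.
\<close>

section \<open>Bounded operators on the Hilbert space\<close>

lemma ell2_iff_finite:
  "finite I \<Longrightarrow> v \<in> ell2 I \<longleftrightarrow> (\<forall>x. x \<notin> I \<longrightarrow> v x = 0)"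
  by (simp add: ell2_def)

lemma ell2_norm_nonneg: "0 \<le> ell2_norm I v"
  by (simp add: ell2_norm_def infsum_nonneg)

lemma ell2_cmult:
  assumes "v \<in> ell2 I"
  shows "(\<lambda>x. c * v x) \<in> ell2 I" and "ell2_norm I (\<lambda>x. c * v x) \<le> cmod c * ell2_norm I v"
proof -
  have "(\<Sum>x\<in>F. (cmod (c * v x))\<^sup>2) \<le> (cmod c * ell2_norm I v)\<^sup>2" if "finite F" "F \<subseteq> I" for F
    using mult_left_mono[OF ell2_finite_sum_le[OF assms that], of "(cmod c)\<^sup>2"]
    by (simp add: norm_mult power_mult_distrib sum_distrib_left)
  moreover have "c * v x = 0" if "x \<notin> I" for x using assms that by (simp add: ell2_def)
  ultimately show "(\<lambda>x. c * v x) \<in> ell2 I"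
    and "ell2_norm I (\<lambda>x. c * v x) \<le> cmod c * ell2_norm I v"
    using ell2_bounded_sums[of I "\<lambda>x. c * v x" "cmod c * ell2_norm I v"]
    by (simp_all add: ell2_norm_nonneg)
qed

lemma ell2_add:
  assumes "u \<in> ell2 I" "v \<in> ell2 I"
  shows "(\<lambda>x. u x + v x) \<in> ell2 I"
  using ell2_diff[OF assms(1) ell2_cmult(1)[OF assms(2), of "-1"]] by simp

text \<open>The pointwise estimate \<open>|a + b|^2 \<le> 2 |a|^2 + 2 |b|^2\<close> gives the crude
  factor 2, which is enough for boundedness of sums of operators.\<close>

lemma ell2_norm_add_le:
  assumes "u \<in> ell2 I" "v \<in> ell2 I"
  shows "ell2_norm I (\<lambda>x. u x + v x) \<le> 2 * (ell2_norm I u + ell2_norm I v)"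
proof (rule ell2_bounded_sums(2))
  show "u x + v x = 0" if "x \<notin> I" for x using assms that by (simp add: ell2_def)
  show "0 \<le> 2 * (ell2_norm I u + ell2_norm I v)" by (simp add: ell2_norm_nonneg)
  fix F assume F: "finite F" "F \<subseteq> I"
  have "(cmod (u x + v x))\<^sup>2 \<le> 2 * (cmod (u x))\<^sup>2 + 2 * (cmod (v x))\<^sup>2" for x
  proof -
    have "(cmod (u x + v x))\<^sup>2 \<le> (cmod (u x) + cmod (v x))\<^sup>2"
      by (intro power_mono norm_triangle_ineq) simp
    also have "\<dots> \<le> 2 * (cmod (u x))\<^sup>2 + 2 * (cmod (v x))\<^sup>2"
      using sum_squares_bound[of "cmod (u x)" "cmod (v x)"] by (simp add: power2_sum)
    finally show ?thesis .
  qed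
  then have "(\<Sum>x\<in>F. (cmod (u x + v x))\<^sup>2)
      \<le> 2 * (\<Sum>x\<in>F. (cmod (u x))\<^sup>2) + 2 * (\<Sum>x\<in>F. (cmod (v x))\<^sup>2)"
    unfolding sum_distrib_left sum.distrib[symmetric] by (intro sum_mono)
  also have "\<dots> \<le> 2 * (ell2_norm I u)\<^sup>2 + 2 * (ell2_norm I v)\<^sup>2"
    using ell2_finite_sum_le[OF assms(1) F] ell2_finite_sum_le[OF assms(2) F] by simp
  also have "\<dots> \<le> (2 * (ell2_norm I u + ell2_norm I v))\<^sup>2"
    using ell2_norm_nonneg[of I u] ell2_norm_nonneg[of I v]
    by (simp add: power2_sum power_mult_distrib)
  finally show "(\<Sum>x\<in>F. (cmod (u x + v x))\<^sup>2) \<le> (2 * (ell2_norm I u + ell2_norm I v))\<^sup>2" .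
qed

text \<open>The sum over the first \<open>N\<close> points of the sequence is at least
  \<open>N * c\<^sup>2\<close>, while square summability bounds it by the squared norm.\<close>

lemma ell2_bounded_away_contra:
  assumes v: "v \<in> ell2 I" and f: "inj f" "\<And>k::nat. f k \<in> I"
    and c: "0 < c" "\<And>k. c \<le> cmod (v (f k))"
  shows False
proof -
  have "real N * c\<^sup>2 \<le> (ell2_norm I v)\<^sup>2" for N
  proof -
    have "real N * c\<^sup>2 = (\<Sum>k<N. c\<^sup>2)" by simp
    also have "\<dots> \<le> (\<Sum>k<N. (cmod (v (f k)))\<^sup>2)" using c by (intro sum_mono power_mono) auto
    also have "\<dots> = (\<Sum>x\<in>f ` {..<N}. (cmod (v x))\<^sup>2)"
      using f(1) by (subst sum.reindex) (auto intro: inj_on_subset)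
    also have "\<dots> \<le> (ell2_norm I v)\<^sup>2" using f(2) by (intro ell2_finite_sum_le[OF v]) auto
    finally show ?thesis .
  qed
  moreover obtain N where "(ell2_norm I v)\<^sup>2 / c\<^sup>2 < real N" using reals_Archimedean2 by blast
  ultimately show False using c(1) by (simp add: divide_less_eq not_less[symmetric])
qed

section \<open>Algebra of bounded operators\<close>

lemma bounded_operatorI:
  assumes "\<And>v. v \<in> ell2 I \<Longrightarrow> A v \<in> ell2 I"
    and "\<And>u v. u \<in> ell2 I \<Longrightarrow> v \<in> ell2 I \<Longrightarrow> A (\<lambda>x. u x + v x) = (\<lambda>x. A u x + A v x)"
    and "\<And>c v. v \<in> ell2 I \<Longrightarrow> A (\<lambda>x. c * v x) = (\<lambda>x. c * A v x)"
    and "\<And>v. v \<in> ell2 I \<Longrightarrow> ell2_norm I (A v) \<le> K * ell2_norm I v"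
  shows "bounded_operator I A"
  unfolding bounded_operator_def using assms by (intro conjI exI[of _ K]) auto

lemma bounded_operatorD:
  assumes "bounded_operator I A"
  shows "v \<in> ell2 I \<Longrightarrow> A v \<in> ell2 I"
    and "u \<in> ell2 I \<Longrightarrow> v \<in> ell2 I \<Longrightarrow> A (\<lambda>x. u x + v x) = (\<lambda>x. A u x + A v x)"
    and "v \<in> ell2 I \<Longrightarrow> A (\<lambda>x. c * v x) = (\<lambda>x. c * A v x)"
  using assms by (auto simp: bounded_operator_def)

lemma bounded_operator_bound:
  assumes "bounded_operator I A"
  obtains K where "0 \<le> K" "\<And>v. v \<in> ell2 I \<Longrightarrow> ell2_norm I (A v) \<le> K * ell2_norm I v"
proof -
  obtain K where K: "\<forall>v\<in>ell2 I. ell2_norm I (A v) \<le> K * ell2_norm I v"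
    using assms by (auto simp: bounded_operator_def)
  have "ell2_norm I (A v) \<le> \<bar>K\<bar> * ell2_norm I v" if "v \<in> ell2 I" for v
    using K[rule_format, OF that] mult_right_mono[OF abs_ge_self[of K] ell2_norm_nonneg[of I v]]
    by linarith
  then show thesis using that[of "\<bar>K\<bar>"] by simp
qed

text \<open>Operators are functions on all of \<open>'a \<Rightarrow> complex\<close>, but only
  their values on \<open>ell2 I\<close> carry meaning, so identities valid there may replace one by
  another.\<close>

lemma bounded_operator_cong:
  assumes "bounded_operator I A" "\<And>v. v \<in> ell2 I \<Longrightarrow> B v = A v"
  shows "bounded_operator I B"
  using assms unfolding bounded_operator_def by (auto simp: ell2_add ell2_cmult(1))

lemma bounded_operator_id: "bounded_operator I (\<lambda>v. v)"
  unfolding bounded_operator_def by (auto intro!: exI[of _ 1])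

lemma bounded_operator_cmult:
  assumes A: "bounded_operator I A"
  shows "bounded_operator I (\<lambda>v x. c * A v x)"
proof -
  obtain K where K: "0 \<le> K" "\<And>v. v \<in> ell2 I \<Longrightarrow> ell2_norm I (A v) \<le> K * ell2_norm I v"
    using bounded_operator_bound[OF A] by blast
  have bound: "ell2_norm I (\<lambda>x. c * A v x) \<le> (cmod c * K) * ell2_norm I v" if "v \<in> ell2 I" for v
    using ell2_cmult(2)[OF bounded_operatorD(1)[OF A that], of c]
      mult_left_mono[OF K(2)[OF that], of "cmod c"] by (simp add: mult.assoc)
  show ?thesis
    using bounded_operatorD[OF A]
    by (intro bounded_operatorI[OF _ _ _ bound] ell2_cmult(1)) (auto simp: algebra_simps)
qed

lemma bounded_operator_add:
  assumes A: "bounded_operator I A" and B: "bounded_operator I B"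
  shows "bounded_operator I (\<lambda>v x. A v x + B v x)"
proof -
  obtain K where K: "0 \<le> K" "\<And>v. v \<in> ell2 I \<Longrightarrow> ell2_norm I (A v) \<le> K * ell2_norm I v"
    using bounded_operator_bound[OF A] by blast
  obtain L where L: "0 \<le> L" "\<And>v. v \<in> ell2 I \<Longrightarrow> ell2_norm I (B v) \<le> L * ell2_norm I v"
    using bounded_operator_bound[OF B] by blast
  have bound: "ell2_norm I (\<lambda>x. A v x + B v x) \<le> (2 * (K + L)) * ell2_norm I v" if "v \<in> ell2 I" for v
    using ell2_norm_add_le[OF bounded_operatorD(1)[OF A that] bounded_operatorD(1)[OF B that]]
      K(2)[OF that] L(2)[OF that] by (simp add: algebra_simps)
  show ?thesis
    using bounded_operatorD[OF A] bounded_operatorD[OF B]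
    by (intro bounded_operatorI[OF _ _ _ bound] ell2_add) (auto simp: algebra_simps)
qed

lemma bounded_operator_comp:
  assumes A: "bounded_operator I A" and B: "bounded_operator I B"
  shows "bounded_operator I (\<lambda>v. A (B v))"
proof -
  obtain K where K: "0 \<le> K" "\<And>v. v \<in> ell2 I \<Longrightarrow> ell2_norm I (A v) \<le> K * ell2_norm I v"
    using bounded_operator_bound[OF A] by blast
  obtain L where L: "0 \<le> L" "\<And>v. v \<in> ell2 I \<Longrightarrow> ell2_norm I (B v) \<le> L * ell2_norm I v"
    using bounded_operator_bound[OF B] by blast
  have bound: "ell2_norm I (A (B v)) \<le> (K * L) * ell2_norm I v" if "v \<in> ell2 I" for v
    using K(2)[OF bounded_operatorD(1)[OF B that]] mult_left_mono[OF L(2)[OF that] K(1)]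
    by (simp add: mult.assoc)
  show ?thesis
    using bounded_operatorD[OF A] bounded_operatorD[OF B]
    by (intro bounded_operatorI[OF _ _ _ bound]) auto
qed

lemma bounded_operator_lin_comb_op:
  assumes "\<And>i. i \<le> n \<Longrightarrow> bounded_operator I (A i)"
  shows "bounded_operator I (lin_comb_op n A x)"
  using assms
proof (induction n)
  case 0
  then show ?case by (simp add: lin_comb_op_def bounded_operator_cmult)
next
  case (Suc n)
  have "bounded_operator I (\<lambda>v y. lin_comb_op n A x v y + x (Suc n) * A (Suc n) v y)"
    using Suc by (intro bounded_operator_add bounded_operator_cmult) auto
  then show ?case by (simp add: lin_comb_op_def)
qed

section \<open>Invertible operators\<close>

lemma invertible_operator_cong:
  assumes "invertible_operator I A" "\<And>v. v \<in> ell2 I \<Longrightarrow> B v = A v"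
  shows "invertible_operator I B"
proof -
  obtain A' where "bounded_operator I A" "bounded_operator I A'"
      "\<forall>v\<in>ell2 I. A (A' v) = v \<and> A' (A v) = v"
    using assms(1) by (auto simp: invertible_operator_def)
  then show ?thesis unfolding invertible_operator_def
    using assms(2) bounded_operator_cong[of I A B] by (metis bounded_operatorD(1))
qed

lemma invertible_operator_comp:
  assumes "invertible_operator I A" "invertible_operator I B"
  shows "invertible_operator I (\<lambda>v. A (B v))"
proof -
  obtain A' where A: "bounded_operator I A" "bounded_operator I A'"
      "\<forall>v\<in>ell2 I. A (A' v) = v \<and> A' (A v) = v"
    using assms(1) by (auto simp: invertible_operator_def)
  obtain B' where B: "bounded_operator I B" "bounded_operator I B'"
      "\<forall>v\<in>ell2 I. B (B' v) = v \<and> B' (B v) = v"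
    using assms(2) by (auto simp: invertible_operator_def)
  have "A (B (B' (A' v))) = v \<and> B' (A' (A (B v))) = v" if "v \<in> ell2 I" for v
    using A B that bounded_operatorD(1) by metis
  then show ?thesis unfolding invertible_operator_def
    using bounded_operator_comp[OF A(1) B(1)] bounded_operator_comp[OF B(2) A(2)] by blast
qed

lemma invertible_operator_cmult_iff:
  assumes "c \<noteq> 0"
  shows "invertible_operator I (\<lambda>v x. c * A v x) \<longleftrightarrow> invertible_operator I A"
proof -
  have *: "invertible_operator I (\<lambda>v x. c * A v x)" if "invertible_operator I A" "c \<noteq> 0" for c A
  proof -
    have "invertible_operator I (\<lambda>v x. c * v x)"
      unfolding invertible_operator_def
      using that(2) bounded_operator_cmult[OF bounded_operator_id]
      by (intro conjI exI[of _ "\<lambda>v x. inverse c * v x"]) auto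
    from invertible_operator_comp[OF this that(1)] show ?thesis .
  qed
  show ?thesis using *[of A c] *[of "\<lambda>v x. c * A v x" "inverse c"] assms
    by (auto simp: mult.assoc[symmetric])
qed

text \<open>Since \<open>A C = A B A = C A\<close>, the operator \<open>A\<close> also commutes with
  the inverse \<open>C'\<close> of \<open>C\<close>, so \<open>B C'\<close> is a two-sided bounded
  inverse of \<open>A\<close>.\<close>

lemma invertible_operator_commuting_factor:
  assumes A: "bounded_operator I A" and B: "bounded_operator I B" and C: "invertible_operator I C"
    and AB: "\<And>v. v \<in> ell2 I \<Longrightarrow> A (B v) = C v" and BA: "\<And>v. v \<in> ell2 I \<Longrightarrow> B (A v) = C v"
  shows "invertible_operator I A"
proof -
  obtain C' where C': "bounded_operator I C'" "\<And>v. v \<in> ell2 I \<Longrightarrow> C (C' v) = v"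
      "\<And>v. v \<in> ell2 I \<Longrightarrow> C' (C v) = v"
    using C by (auto simp: invertible_operator_def)
  note cl = bounded_operatorD(1)[OF A] bounded_operatorD(1)[OF B] bounded_operatorD(1)[OF C'(1)]
  have "A (B (C' v)) = v \<and> B (C' (A v)) = v" if v: "v \<in> ell2 I" for v
  proof -
    have "C' (A v) = C' (A (C (C' v)))" using C' v by simp
    also have "\<dots> = C' (C (A (C' v)))" using AB BA cl v by metis
    also have "\<dots> = A (C' v)" using C' cl v by simp
    finally show ?thesis using AB BA C' cl v by simp
  qed
  then show ?thesis unfolding invertible_operator_def
    using A bounded_operator_comp[OF B C'(1)] by blast
qed

lemma invertible_operator_surj:
  assumes "invertible_operator I A" "w \<in> ell2 I"
  obtains v where "v \<in> ell2 I" "A v = w"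
  using assms by (auto simp: invertible_operator_def bounded_operator_def)

lemma invertible_operator_left_cancel:
  assumes "invertible_operator I A" "v \<in> ell2 I" "A v = (\<lambda>x. 0)"
  shows "v = (\<lambda>x. 0)"
proof -
  obtain B where B: "bounded_operator I B" "B (A v) = v"
    using assms by (auto simp: invertible_operator_def)
  have "(\<lambda>x. 0) \<in> ell2 I" by (simp add: ell2_def)
  from bounded_operatorD(3)[OF B(1) this, of 0] have "B (\<lambda>x. 0) = (\<lambda>x. 0)" by simp
  then show ?thesis using B assms(3) by simp
qed

lemma basis_vec_ell2: "h \<in> I \<Longrightarrow> basis_vec h \<in> ell2 I"
proof (rule ell2_bounded_sums(1))
  show "(\<Sum>x\<in>F. (cmod (basis_vec h x))\<^sup>2) \<le> 1\<^sup>2" if "finite F" for F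
  proof -
    have "(\<Sum>x\<in>F. (cmod (basis_vec h x))\<^sup>2) = (\<Sum>x\<in>F. if x = h then 1 else 0)"
      by (intro sum.cong) (auto simp: basis_vec_def)
    then show ?thesis using that by simp
  qed
qed (auto simp: basis_vec_def)

section \<open>Projective joint spectra\<close>

text \<open>Two representatives of a point differ by a nonzero scalar, and so do the pencils, so
  invertibility can be tested on any of them.\<close>

lemma proj_point_in_spectrum_iff:
  assumes x: "x \<in> hom_coords n"
  shows "proj_point x \<in> proj_joint_spectrum I n A \<longleftrightarrow> \<not> invertible_operator I (lin_comb_op n A x)"
proof
  assume "proj_point x \<in> proj_joint_spectrum I n A"
  then obtain y where y: "proj_point x = proj_point y" "\<not> invertible_operator I (lin_comb_op n A y)"
    by (auto simp: proj_joint_spectrum_def)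
  have "y \<in> proj_point y" by (auto simp: proj_point_def intro!: exI[of _ 1])
  then obtain c where c: "c \<noteq> 0" "y = (\<lambda>i. c * x i)"
    unfolding y(1)[symmetric] by (auto simp: proj_point_def)
  have "lin_comb_op n A y = (\<lambda>v z. c * lin_comb_op n A x v z)"
    by (simp add: c lin_comb_op_def sum_distrib_left mult.assoc)
  then show "\<not> invertible_operator I (lin_comb_op n A x)"
    using y(2) invertible_operator_cmult_iff[OF c(1)] by metis
next
  assume "\<not> invertible_operator I (lin_comb_op n A x)"
  then show "proj_point x \<in> proj_joint_spectrum I n A"
    unfolding proj_joint_spectrum_def using x by blast
qed

lemma spectrum_subset_iff:
  "proj_joint_spectrum I n A \<subseteq> proj_joint_spectrum J n B \<longleftrightarrow>
    (\<forall>x\<in>hom_coords n. invertible_operator J (lin_comb_op n B x) \<longrightarrow>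
      invertible_operator I (lin_comb_op n A x))"
  (is "?L \<longleftrightarrow> ?R")
proof
  assume ?L
  then show ?R by (metis proj_point_in_spectrum_iff subsetD)
next
  assume R: ?R
  show ?L
  proof
    fix p assume "p \<in> proj_joint_spectrum I n A"
    then obtain x where "x \<in> hom_coords n" "p = proj_point x"
        "\<not> invertible_operator I (lin_comb_op n A x)"
      by (auto simp: proj_joint_spectrum_def)
    then show "p \<in> proj_joint_spectrum J n B" using R proj_point_in_spectrum_iff by metis
  qed
qed

section \<open>The left regular representation\<close>

context group
begin

lemma left_regular_mult:
  assumes "g \<in> carrier G" "h \<in> carrier G"
  shows "left_regular G g (left_regular G h v) = left_regular G (g \<otimes> h) v"
  using assms by (auto simp: left_regular_def fun_eq_iff inv_mult_group m_assoc)

lemma left_regular_one: "v \<in> ell2 (carrier G) \<Longrightarrow> left_regular G \<one> v = v"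
  by (auto simp: left_regular_def fun_eq_iff ell2_def)

lemma left_regular_linear:
  "left_regular G g (\<lambda>x. u x + v x) = (\<lambda>x. left_regular G g u x + left_regular G g v x)"
  "left_regular G g (\<lambda>x. u x - v x) = (\<lambda>x. left_regular G g u x - left_regular G g v x)"
  "left_regular G g (\<lambda>x. c * v x) = (\<lambda>x. c * left_regular G g v x)"
  by (auto simp: left_regular_def fun_eq_iff)

lemma invertible_left_regular:
  assumes "g \<in> carrier G"
  shows "invertible_operator (carrier G) (left_regular G g)"
  unfolding invertible_operator_def using assms
  by (auto intro!: bounded_operator_left_regular exI[of _ "left_regular G (inv g)"] is_group
      simp: left_regular_mult left_regular_one)

text \<open>With \<open>\<zeta>\<^bsup>ord h\<^esup> = 1\<close>, which is vacuous if \<open>h\<close> has infinite order (\<open>ord h = 0\<close>), a solution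
  of \<open>(\<lambda>(h) - \<zeta>) v = 1\<^sub>G\<close> has to jump at \<open>1\<^sub>G\<close> along the cyclic group generated by \<open>h\<close>, which
  contradicts periodicity or square summability.\<close>

lemma not_invertible_left_regular_minus:
  assumes h: "h \<in> carrier G" and z: "cmod z = 1" "z ^ ord h = 1"
  shows "\<not> invertible_operator (carrier G) (\<lambda>v x. left_regular G h v x - z * v x)"
proof
  assume "invertible_operator (carrier G) (\<lambda>v x. left_regular G h v x - z * v x)"
  then obtain v where v: "v \<in> ell2 (carrier G)"
      and eq: "(\<lambda>x. left_regular G h v x - z * v x) = basis_vec \<one>"
    using invertible_operator_surj[OF _ basis_vec_ell2[OF one_closed]] by blast
  have step: "v (inv h \<otimes> x) - z * v x = (if x = \<one> then 1 else 0)" if "x \<in> carrier G" for x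
    using fun_cong[OF eq, of x] that by (simp add: left_regular_def basis_vec_def)
  \<comment> \<open>Evaluation at \<open>h [^] Suc k\<close> follows \<open>v\<close> along the
    positive powers of \<open>h\<close>; the right-hand side is nonzero only on a return to the
    identity.\<close>
  have fwd: "v (h [^] k) - z * v (h [^] Suc k) = (if h [^] Suc k = \<one> then 1 else 0)" for k :: nat
  proof -
    have "inv h \<otimes> h [^] Suc k = h [^] k"
      using h by (metis nat_pow_Suc2 inv_closed l_inv l_one m_assoc nat_pow_closed)
    then show ?thesis using step[of "h [^] Suc k"] h by simp
  qed
  show False
  proof (cases "ord h = 0")
    case False
    \<comment> \<open>No power strictly between \<open>0\<close> and \<open>ord h\<close> is the
      identity, so there is no jump and the factors \<open>z\<close> accumulate.\<close>
    have c: "v \<one> = z ^ k * v (h [^] k)" if "k < ord h" for k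
      using that
    proof (induction k)
      case (Suc k)
      then have "h [^] Suc k \<noteq> \<one>" using pow_eq_id[OF h, of "Suc k"] dvd_imp_le by fastforce
      then have "v (h [^] k) = z * v (h [^] Suc k)" using fwd[of k] by simp
      then show ?case using Suc by (simp del: nat_pow_Suc)
    qed simp
    obtain d where d: "ord h = Suc d" using False not0_implies_Suc by blast
    \<comment> \<open>The last step, from \<open>h [^] d\<close> back to the identity, carries the
      jump. After scaling by \<open>z ^ d\<close> the left side cancels because
      \<open>z ^ ord h = 1\<close>, but the right side is nonzero.\<close>
    have "v (h [^] d) - z * v \<one> = 1" using fwd[of d] pow_ord_eq_1[OF h] by (simp add: d)
    then have "z ^ d * v (h [^] d) - z ^ Suc d * v \<one> = z ^ d" by (simp add: algebra_simps)
    then show False using c[of d] z d by auto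
  next
    case True
    have np: "h [^] k \<noteq> \<one>" if "k \<noteq> 0" for k :: nat using True h that by (simp add: ord_eq_0)
    have inj: "inj (\<lambda>k::nat. h [^] k)"
    proof (rule injI)
      fix k l :: nat assume "h [^] k = h [^] l"
      then show "k = l"
        using np[of "k - l"] np[of "l - k"] pow_eq_div2[OF h, of k l] pow_eq_div2[OF h, of l k]
        by (metis diff_is_0_eq le_antisym)
    qed
    \<comment> \<open>Along the positive powers the modulus of \<open>v\<close> is constant, so
      square summability forces \<open>v\<close> to vanish there, in particular at the
      identity.\<close>
    have "v (h [^] k) = z * v (h [^] Suc k)" for k :: nat
      using fwd[of k] np[of "Suc k"] by (simp del: nat_pow_Suc)
    then have "cmod (v (h [^] k)) = cmod (v (h [^] Suc k))" for k :: nat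
      using z(1) by (metis mult_1 norm_mult)
    then have "cmod (v (h [^] k)) = cmod (v \<one>)" for k :: nat by (induction k) simp_all
    then have v1: "v \<one> = 0"
      using ell2_bounded_away_contra[OF v inj, of "cmod (v \<one>)"] h by fastforce
    have "inv h \<otimes> inv (h [^] k) = inv (h [^] Suc k)" for k :: nat
      using h by (simp add: inv_mult_group)
    \<comment> \<open>In the negative direction the jump occurs at the first step: with
      \<open>v \<one> = 0\<close> it gives modulus 1 at \<open>inv h\<close>, and this modulus
      persists along an infinite set.\<close>
    then have bwd: "v (inv (h [^] Suc k)) - z * v (inv (h [^] k)) = (if k = 0 then 1 else 0)"
      for k :: nat
      using step[of "inv (h [^] k)"] h np[of k] by auto
    have "cmod (v (inv (h [^] Suc k))) = 1" for k :: nat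
    proof (induction k)
      case 0
      then show ?case using bwd[of 0] v1 by simp
    next
      case (Suc k)
      have "v (inv (h [^] Suc (Suc k))) = z * v (inv (h [^] Suc k))" using bwd[of "Suc k"] by simp
      then show ?case using Suc z(1) by (simp add: norm_mult del: nat_pow_Suc)
    qed
    moreover have "inj (\<lambda>k. inv (h [^] Suc k))"
      using inj h unfolding inj_on_def by (metis inv_inv nat_pow_closed nat.inject UNIV_I)
    ultimately show False
      using ell2_bounded_away_contra[OF v, of "\<lambda>k. inv (h [^] Suc k)" 1] h by simp
  qed
qed

text \<open>Supplies a spectral value of left translation by \<open>h\<close> that is not an m-th
  root of unity; the conditions on \<open>z\<close> match those of
  \<open>not_invertible_left_regular_minus\<close>.\<close>

lemma ex_unit_root_separating_order:
  assumes h: "h \<in> carrier G" and m: "0 < m" "h [^] m \<noteq> \<one>"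
  obtains z where "cmod z = 1" "z ^ ord h = 1" "z ^ m \<noteq> 1"
proof (cases "ord h = 0")
  case True
  \<comment> \<open>For infinite order the condition \<open>z ^ ord h = 1\<close> reads
    \<open>z ^ 0 = 1\<close>, so a unimodular \<open>z\<close> with \<open>z ^ m = -1\<close>
    works.\<close>
  have "cis (pi / m) ^ m = -1" using m(1) by (simp add: DeMoivre)
  then show thesis using True that[of "cis (pi / m)"] by simp
next
  case False
  define k where "k = ord h"
  have k: "0 < k" "\<not> k dvd m" using False m(2) pow_eq_id[OF h] by (auto simp: k_def)
  have 1: "cis (2 * pi / k) ^ k = 1" using k(1) by (simp add: DeMoivre)
  \<comment> \<open>A primitive k-th root of unity has m-th power 1 only if \<open>k dvd m\<close>,
    which is excluded.\<close>
  have "cis (2 * pi / k) ^ m \<noteq> 1"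
  proof
    assume "cis (2 * pi / k) ^ m = 1"
    then have "cos (m * (2 * pi / k)) = 1" by (metis DeMoivre cis.sel(1) one_complex.sel(1))
    then obtain j :: int where "m * (2 * pi / k) = of_int j * 2 * pi"
      using cos_one_2pi_int by blast
    then have "real m = of_int j * real k" using k(1) by (simp add: field_simps)
    then have "int m = j * int k" by (metis of_int_eq_iff of_int_mult of_int_of_nat_eq)
    then have "int k dvd int m" by simp
    then show False using k(2) by simp
  qed
  then show thesis using 1 that[of "cis (2 * pi / k)"] by (simp add: k_def)
qed

lemma bounded_left_regular_minus:
  assumes h: "h \<in> carrier G"
  shows "bounded_operator (carrier G) (\<lambda>v x. left_regular G h v x - z * v x)"
  using bounded_operator_add[OF bounded_operator_left_regular[OF is_group h]
      bounded_operator_cmult[OF bounded_operator_id, of _ "-z"]] by simp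

text \<open>With \<open>U\<close> for translation by \<open>h\<close>, \<open>U ^ m = 1\<close> and
  the geometric sum give \<open>(U - z) * (\<Sum>i<m. z ^ (m - 1 - i) * U ^ i) = 1 - z ^ m\<close>,
  a nonzero scalar.\<close>

lemma invertible_left_regular_minus:
  assumes h: "h \<in> carrier G" and m: "0 < m" "h [^] m = \<one>" and z: "z ^ m \<noteq> 1"
  shows "invertible_operator (carrier G) (\<lambda>v x. left_regular G h v x - z * v x)"
proof (rule invertible_operator_commuting_factor)
  let ?B = "lin_comb_op (m - 1) (\<lambda>i. left_regular G (h [^] i)) (\<lambda>i. z ^ (m - Suc i))"
  let ?C = "\<lambda>v x. (1 - z ^ m) * v x :: complex"
  show "bounded_operator (carrier G) (\<lambda>v x. left_regular G h v x - z * v x)"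
    using h by (rule bounded_left_regular_minus)
  show "bounded_operator (carrier G) ?B"
    using h by (intro bounded_operator_lin_comb_op bounded_operator_left_regular is_group) simp
  show "invertible_operator (carrier G) ?C"
    unfolding invertible_operator_def
    using z bounded_operator_cmult[OF bounded_operator_id]
    by (intro conjI exI[of _ "\<lambda>v x. inverse (1 - z ^ m) * v x"])
      (auto simp: mult.assoc[symmetric])
  fix v :: "'a \<Rightarrow> complex" assume v: "v \<in> ell2 (carrier G)"
  \<comment> \<open>The products telescope: \<open>f m\<close> is \<open>v\<close> and
    \<open>f 0\<close> is \<open>z ^ m\<close> times \<open>v\<close>.\<close>
  define f where "f = (\<lambda>i x. z ^ (m - i) * left_regular G (h [^] i) v x)"
  \<comment> \<open>\<open>lin_comb_op\<close> includes its upper bound, hence \<open>m - 1\<close>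
    and the use of \<open>0 < m\<close>.\<close>
  have set: "{..m - 1} = {..<m}" using m(1) by auto
  have tel: "(\<Sum>i<m. f (Suc i) x - f i x) = (1 - z ^ m) * v x" for x
    using left_regular_one[OF v]
    by (subst sum_lessThan_telescope) (simp add: f_def m(2) algebra_simps)
  have zz: "z * z ^ (m - Suc i) = z ^ (m - i)" if "i < m" for i
    using that by (metis Suc_diff_Suc power_Suc)
  have off: "left_regular G g v x = 0" if "x \<notin> carrier G" for g v x
    using that by (simp add: left_regular_def)
  have 1: "left_regular G h (left_regular G (h [^] i) v) = left_regular G (h [^] Suc i) v"
    and 2: "left_regular G (h [^] i) (left_regular G h v) = left_regular G (h [^] Suc i) v" for i
    using h by (auto simp only: left_regular_mult nat_pow_closed nat_pow_Suc2[symmetric]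
        nat_pow_Suc[symmetric])
  have L: "left_regular G h (\<lambda>x. \<Sum>i<m. c i * w i x)
      = (\<lambda>x. \<Sum>i<m. c i * left_regular G h (w i) x)" for c w
    by (auto simp: left_regular_def fun_eq_iff)
  show "(\<lambda>x. left_regular G h (?B v) x - z * ?B v x) = ?C v"
    unfolding lin_comb_op_def set L 1 tel[symmetric] f_def sum_distrib_left
      sum_subtractf[symmetric]
    by (intro ext sum.cong) (auto simp: zz mult.assoc[symmetric])
  show "?B (\<lambda>x. left_regular G h v x - z * v x) = ?C v"
    unfolding lin_comb_op_def set left_regular_linear 2 tel[symmetric] f_def
    by (intro ext sum.cong) (auto simp: zz[symmetric] algebra_simps)
qed

text \<open>This is the pencil at the point with coordinate \<open>c\<close> at the identity, 1 at
  \<open>a\<close> and \<open>b\<close>, and 0 elsewhere. Two involutions generate a dihedral group,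
  whence the name.\<close>

definition dihedral_pencil :: "'a \<Rightarrow> 'a \<Rightarrow> complex \<Rightarrow> ('a \<Rightarrow> complex) \<Rightarrow> 'a \<Rightarrow> complex" where
  "dihedral_pencil a b c v = (\<lambda>x. c * v x + left_regular G a v x + left_regular G b v x)"

lemma bounded_dihedral_pencil:
  assumes "a \<in> carrier G" "b \<in> carrier G"
  shows "bounded_operator (carrier G) (dihedral_pencil a b c)"
  unfolding dihedral_pencil_def
  using assms by (intro bounded_operator_add bounded_operator_cmult bounded_operator_id
      bounded_operator_left_regular is_group)

text \<open>Writing \<open>s = a + b\<close> and \<open>r = a b\<close>, involutions satisfy
  \<open>s\<^sup>2 - c\<^sup>2 = r + r\<^sup>-\<^sup>1 - \<zeta> - \<zeta>\<^sup>-\<^sup>1 = r\<^sup>-\<^sup>1 (r - \<zeta>) (r - \<zeta>\<^sup>-\<^sup>1)\<close>.\<close>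

lemma dihedral_pencil_factorization:
  assumes ab: "a \<in> carrier G" "b \<in> carrier G" "a \<otimes> a = \<one>" "b \<otimes> b = \<one>"
    and c: "c * c = 2 + z + inverse z" "z \<noteq> 0" and v: "v \<in> ell2 (carrier G)"
    and r: "r = a \<otimes> b"
  shows "dihedral_pencil a b c (dihedral_pencil a b (- c) v)
    = left_regular G (inv r) (\<lambda>x. left_regular G r (\<lambda>x. left_regular G r v x - inverse z * v x) x
        - z * (left_regular G r v x - inverse z * v x))"
proof -
  have "inv a = a" "inv b = b" using ab by (auto intro: inv_equality)
  then have r': "a \<otimes> b = r" "b \<otimes> a = inv r" "r \<in> carrier G"
    using ab by (auto simp: r inv_mult_group)
  then have rr: "inv r \<otimes> r = \<one>" "inv r \<otimes> (r \<otimes> r) = r"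
    by (auto simp: m_assoc[symmetric])
  note L = left_regular_linear left_regular_mult left_regular_one[OF v] ab r' rr m_closed inv_closed
  have 1: "left_regular G a (dihedral_pencil a b (- c) v)
      = (\<lambda>x. - c * left_regular G a v x + v x + left_regular G r v x)"
    unfolding dihedral_pencil_def by (simp only: L)
  have 2: "left_regular G b (dihedral_pencil a b (- c) v)
      = (\<lambda>x. - c * left_regular G b v x + left_regular G (inv r) v x + v x)"
    unfolding dihedral_pencil_def by (simp only: L)
  have 3: "left_regular G (inv r) (\<lambda>x. left_regular G r (\<lambda>x. left_regular G r v x - inverse z * v x) x
        - z * (left_regular G r v x - inverse z * v x))
      = (\<lambda>x. left_regular G r v x - inverse z * v x
          - z * (v x - inverse z * left_regular G (inv r) v x))"
    by (simp only: L)
  \<comment> \<open>The letters \<open>p\<close>, \<open>q\<close>, \<open>q'\<close>,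
    \<open>t\<close>, \<open>t'\<close> stand for the values of \<open>v\<close> and of its
    translates by \<open>a\<close>, \<open>b\<close>, \<open>r\<close> and \<open>inv r\<close> at a
    point.\<close>
  have eq: "c * (- c * p + q + q') + (- c * q + p + t) + (- c * q' + t' + p)
      = t - inverse z * p - z * (p - inverse z * t')" for p q q' t t' :: complex
  proof -
    have "z * (inverse z * t') = t'" using c(2) by simp
    moreover have "c * (c * p) = (2 + z + inverse z) * p" using c(1) by (simp flip: mult.assoc)
    ultimately show ?thesis by (simp add: algebra_simps)
  qed
  show ?thesis
    unfolding 3 dihedral_pencil_def[of a b c "dihedral_pencil a b (- c) v"] 1 2
    unfolding dihedral_pencil_def[of a b "- c" v] by (intro ext eq)
qed

lemma left_regular_minus_commute:
  assumes "g \<in> carrier G" "h \<in> carrier G" "g \<otimes> h = h \<otimes> g"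
  shows "left_regular G g (\<lambda>x. left_regular G h v x - z * v x)
    = (\<lambda>x. left_regular G h (left_regular G g v) x - z * left_regular G g v x)"
  by (simp only: left_regular_linear left_regular_mult assms)

text \<open>The product of the pencils at \<open>c\<close> and \<open>- c\<close> is invertible, and
  \<open>r - z\<close> is a factor of it; the factors \<open>inv r\<close>, \<open>r - z\<close> and
  \<open>r - inverse z\<close> commute, so \<open>r - z\<close> is invertible too.\<close>

lemma invertible_dihedral_pencilD:
  assumes ab: "a \<in> carrier G" "b \<in> carrier G" "a \<otimes> a = \<one>" "b \<otimes> b = \<one>"
    and c: "c * c = 2 + z + inverse z" "z \<noteq> 0"
    and inv: "invertible_operator (carrier G) (dihedral_pencil a b c)"
      "invertible_operator (carrier G) (dihedral_pencil a b (- c))"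
  shows "invertible_operator (carrier G) (\<lambda>v x. left_regular G (a \<otimes> b) v x - z * v x)"
proof -
  define r where "r = a \<otimes> b"
  have r: "r \<in> carrier G" using ab by (simp add: r_def)
  let ?A = "\<lambda>v x. left_regular G r v x - z * v x"
  let ?B = "\<lambda>v x. left_regular G r v x - inverse z * v x"
  have b: "bounded_operator (carrier G) (\<lambda>v. left_regular G (inv r) (?B v))"
    using bounded_operator_comp[OF bounded_operator_left_regular[OF is_group]
        bounded_left_regular_minus, of "inv r" r] r by simp
  have C: "left_regular G (inv r) (?A (?B v)) = dihedral_pencil a b c (dihedral_pencil a b (- c) v)"
    if "v \<in> ell2 (carrier G)" for v
    using dihedral_pencil_factorization[OF ab c that r_def] by simp
  have "invertible_operator (carrier G) ?A"
    using bounded_left_regular_minus[OF r] b invertible_operator_comp[OF inv]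
  proof (rule invertible_operator_commuting_factor)
    fix v assume v: "v \<in> ell2 (carrier G)"
    show "?A (left_regular G (inv r) (?B v)) = dihedral_pencil a b c (dihedral_pencil a b (- c) v)"
      unfolding C[OF v, symmetric]
      using r by (intro left_regular_minus_commute[symmetric]) auto
    have "?B (?A v) = ?A (?B v)"
      by (simp only: left_regular_linear) (simp add: algebra_simps)
    then show "left_regular G (inv r) (?B (?A v))
        = dihedral_pencil a b c (dihedral_pencil a b (- c) v)"
      using C[OF v] by simp
  qed
  then show ?thesis by (simp add: r_def)
qed

lemma invertible_dihedral_pencilI:
  assumes ab: "a \<in> carrier G" "b \<in> carrier G" "a \<otimes> a = \<one>" "b \<otimes> b = \<one>"
    and c: "c * c = 2 + z + inverse z" "z \<noteq> 0"
    and inv: "invertible_operator (carrier G) (\<lambda>v x. left_regular G (a \<otimes> b) v x - z * v x)"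
      "invertible_operator (carrier G) (\<lambda>v x. left_regular G (a \<otimes> b) v x - inverse z * v x)"
  shows "invertible_operator (carrier G) (dihedral_pencil a b c)"
proof -
  define r where "r = a \<otimes> b"
  have r: "r \<in> carrier G" using ab by (simp add: r_def)
  let ?A = "\<lambda>v x. left_regular G r v x - z * v x"
  let ?B = "\<lambda>v x. left_regular G r v x - inverse z * v x"
  let ?C = "\<lambda>v. left_regular G (inv r) (?A (?B v))"
  have C: "invertible_operator (carrier G) ?C"
    using invertible_operator_comp[OF invertible_left_regular invertible_operator_comp, of "inv r",
        OF _ inv[folded r_def]] r by simp
  \<comment> \<open>The factorization depends on \<open>c\<close> only through its square, so both
    orders of the pencils at \<open>c\<close> and \<open>- c\<close> give the same product.\<close>
  have cc: "(- c) * (- c) = 2 + z + inverse z" using c(1) by simp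
  show ?thesis
    using bounded_dihedral_pencil[OF ab(1,2)] bounded_dihedral_pencil[OF ab(1,2)] C
  proof (rule invertible_operator_commuting_factor)
    fix v assume v: "v \<in> ell2 (carrier G)"
    show "dihedral_pencil a b c (dihedral_pencil a b (- c) v) = ?C v"
      using dihedral_pencil_factorization[OF ab c v r_def] .
    show "dihedral_pencil a b (- c) (dihedral_pencil a b c v) = ?C v"
      using dihedral_pencil_factorization[OF ab cc c(2) v r_def] by simp
  qed
qed

end

text \<open>The inclusion of spectra is tested at these points only. For \<open>i = j\<close> the
  second one would weight \<open>g i\<close> just once, hence the condition.\<close>

lemma lin_comb_op_with_one:
  assumes "group G" "v \<in> ell2 (carrier G)"
    and "i \<in> {1..n}" "j \<in> {1..n}"
  shows "lin_comb_op n (\<lambda>i. left_regular G (with_one G g i))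
      (\<lambda>k. if k = 0 then c else if k = i then 1 else 0) v
    = (\<lambda>x. c * v x + left_regular G (g i) v x)"
   and "i \<noteq> j \<Longrightarrow> lin_comb_op n (\<lambda>i. left_regular G (with_one G g i))
      (\<lambda>k. if k = 0 then c else if k = i \<or> k = j then 1 else 0) v
    = (\<lambda>x. c * v x + left_regular G (g i) v x + left_regular G (g j) v x)"
proof -
  interpret group G by fact
  let ?A = "\<lambda>i. left_regular G (with_one G g i)"
  show "lin_comb_op n ?A (\<lambda>k. if k = 0 then c else if k = i then 1 else 0) v
    = (\<lambda>x. c * v x + left_regular G (g i) v x)"
  proof
    fix x
    have "(\<Sum>k\<le>n. (if k = 0 then c else if k = i then 1 else 0) * ?A k v x)
        = (\<Sum>k\<in>{0, i}. (if k = 0 then c else if k = i then 1 else 0) * ?A k v x)"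
      using assms(3) by (intro sum.mono_neutral_right) auto
    then show "lin_comb_op n ?A (\<lambda>k. if k = 0 then c else if k = i then 1 else 0) v x
        = c * v x + left_regular G (g i) v x"
      using assms(2,3) by (simp add: lin_comb_op_def with_one_def left_regular_one)
  qed
  assume ne: "i \<noteq> j"
  show "lin_comb_op n ?A (\<lambda>k. if k = 0 then c else if k = i \<or> k = j then 1 else 0) v
    = (\<lambda>x. c * v x + left_regular G (g i) v x + left_regular G (g j) v x)"
  proof
    fix x
    have "(\<Sum>k\<le>n. (if k = 0 then c else if k = i \<or> k = j then 1 else 0) * ?A k v x)
        = (\<Sum>k\<in>{0, i, j}. (if k = 0 then c else if k = i \<or> k = j then 1 else 0) * ?A k v x)"
      using assms(3,4) by (intro sum.mono_neutral_right) auto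
    then show "lin_comb_op n ?A (\<lambda>k. if k = 0 then c else if k = i \<or> k = j then 1 else 0) v x
        = c * v x + left_regular G (g i) v x + left_regular G (g j) v x"
      using assms(2-4) ne by (simp add: lin_comb_op_def with_one_def left_regular_one)
  qed
qed

section \<open>Relations forced by an inclusion of spectra\<close>

text \<open>Otherwise some unimodular \<open>z\<close> with \<open>z ^ 2 \<noteq> 1\<close> lies in
  the spectrum of \<open>g' i\<close>, whereas \<open>g i - z\<close> is invertible; the point with
  coordinates \<open>- z\<close> at 0 and 1 at \<open>i\<close> then violates the inclusion.\<close>

lemma involution_of_spectrum_subset:
  assumes G: "group G" and G': "group G'"
    and g: "g ` {1..n} \<subseteq> carrier G" and g': "g' ` {1..n} \<subseteq> carrier G'"
    and sub: "D G' n (with_one G' g') \<subseteq> D G n (with_one G g)"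
    and i: "i \<in> {1..n}" and inv: "g i \<otimes>\<^bsub>G\<^esub> g i = \<one>\<^bsub>G\<^esub>"
  shows "g' i \<otimes>\<^bsub>G'\<^esub> g' i = \<one>\<^bsub>G'\<^esub>"
proof (rule ccontr)
  interpret G: group G by (fact G)
  interpret G': group G' by (fact G')
  have gi: "g i \<in> carrier G" and gi': "g' i \<in> carrier G'" using g g' i by auto
  assume "g' i \<otimes>\<^bsub>G'\<^esub> g' i \<noteq> \<one>\<^bsub>G'\<^esub>"
  then have "g' i [^]\<^bsub>G'\<^esub> (2::nat) \<noteq> \<one>\<^bsub>G'\<^esub>" using gi' by (simp add: numeral_2_eq_2)
  then obtain z where z: "cmod z = 1" "z ^ G'.ord (g' i) = 1" "z ^ 2 \<noteq> 1"
    using G'.ex_unit_root_separating_order[OF gi', of 2] by auto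
  define x :: "nat \<Rightarrow> complex" where "x = (\<lambda>k. if k = 0 then - z else if k = i then 1 else 0)"
  have "x \<in> hom_coords n" using i by (auto simp: hom_coords_def x_def)
  moreover have "invertible_operator (carrier G)
      (lin_comb_op n (\<lambda>i. left_regular G (with_one G g i)) x)"
  proof (rule invertible_operator_cong)
    show "invertible_operator (carrier G) (\<lambda>v x. left_regular G (g i) v x - z * v x)"
      using G.invertible_left_regular_minus[OF gi, of 2 z] inv gi z(3) by (simp add: numeral_2_eq_2)
    show "lin_comb_op n (\<lambda>i. left_regular G (with_one G g i)) x v
        = (\<lambda>y. left_regular G (g i) v y - z * v y)" if "v \<in> ell2 (carrier G)" for v
      unfolding x_def lin_comb_op_with_one(1)[OF G that i i] by simp
  qed
  ultimately have "invertible_operator (carrier G')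
      (lin_comb_op n (\<lambda>i. left_regular G' (with_one G' g' i)) x)"
    using sub by (auto simp: D_def spectrum_subset_iff)
  then have "invertible_operator (carrier G') (\<lambda>v x. left_regular G' (g' i) v x - z * v x)"
    by (rule invertible_operator_cong) (auto simp: lin_comb_op_with_one(1)[OF G' _ i i] x_def)
  then show False using G'.not_invertible_left_regular_minus[OF gi' z(1,2)] by blast
qed

text \<open>The pencils at both square roots \<open>c\<close> and \<open>- c\<close> are transferred
  from \<open>G\<close> to \<open>G'\<close>, because it is their product that contains the factor
  \<open>g' i g' j - z\<close>.\<close>

lemma product_order_of_spectrum_subset:
  assumes G: "group G" and G': "group G'"
    and g: "g ` {1..n} \<subseteq> carrier G" and g': "g' ` {1..n} \<subseteq> carrier G'"
    and sub: "D G' n (with_one G' g') \<subseteq> D G n (with_one G g)"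
    and ij: "i \<in> {1..n}" "j \<in> {1..n}" "i \<noteq> j"
    and inv: "g i \<otimes>\<^bsub>G\<^esub> g i = \<one>\<^bsub>G\<^esub>" "g j \<otimes>\<^bsub>G\<^esub> g j = \<one>\<^bsub>G\<^esub>"
      "g' i \<otimes>\<^bsub>G'\<^esub> g' i = \<one>\<^bsub>G'\<^esub>" "g' j \<otimes>\<^bsub>G'\<^esub> g' j = \<one>\<^bsub>G'\<^esub>"
    and k: "0 < k" "(g i \<otimes>\<^bsub>G\<^esub> g j) [^]\<^bsub>G\<^esub> (k::nat) = \<one>\<^bsub>G\<^esub>"
  shows "(g' i \<otimes>\<^bsub>G'\<^esub> g' j) [^]\<^bsub>G'\<^esub> k = \<one>\<^bsub>G'\<^esub>"
proof (rule ccontr)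
  interpret G: group G by (fact G)
  interpret G': group G' by (fact G')
  have gi: "g i \<in> carrier G" "g j \<in> carrier G" and gi': "g' i \<in> carrier G'" "g' j \<in> carrier G'"
    using g g' ij by auto
  assume "(g' i \<otimes>\<^bsub>G'\<^esub> g' j) [^]\<^bsub>G'\<^esub> k \<noteq> \<one>\<^bsub>G'\<^esub>"
  then obtain z where z: "cmod z = 1" "z ^ G'.ord (g' i \<otimes>\<^bsub>G'\<^esub> g' j) = 1" "z ^ k \<noteq> 1"
    using G'.ex_unit_root_separating_order[OF G'.m_closed[OF gi'] k(1)] by auto
  have z0: "z \<noteq> 0" using z(1) by auto
  \<comment> \<open>On the side of \<open>G\<close> the factorization also contains
    \<open>r - inverse z\<close>, so the inverse too must avoid the k-th roots of unity.\<close>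
  have z': "inverse z ^ k \<noteq> 1" using z(3) by (simp add: power_inverse)
  have main: "invertible_operator (carrier G') (G'.dihedral_pencil (g' i) (g' j) c)"
    if c: "c * c = 2 + z + inverse z" for c
  proof -
    define x :: "nat \<Rightarrow> complex"
      where "x = (\<lambda>k. if k = 0 then c else if k = i \<or> k = j then 1 else 0)"
    have "x \<in> hom_coords n" using ij by (auto simp: hom_coords_def x_def)
    moreover have "invertible_operator (carrier G) (G.dihedral_pencil (g i) (g j) c)"
      using G.invertible_dihedral_pencilI[OF gi inv(1,2) c z0]
        G.invertible_left_regular_minus[OF G.m_closed[OF gi] k] z(3) z' by blast
    then have "invertible_operator (carrier G)
        (lin_comb_op n (\<lambda>i. left_regular G (with_one G g i)) x)"
    proof (rule invertible_operator_cong)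
      show "lin_comb_op n (\<lambda>i. left_regular G (with_one G g i)) x v
          = G.dihedral_pencil (g i) (g j) c v" if "v \<in> ell2 (carrier G)" for v
        unfolding x_def lin_comb_op_with_one(2)[OF G that ij] G.dihedral_pencil_def ..
    qed
    ultimately have "invertible_operator (carrier G')
        (lin_comb_op n (\<lambda>i. left_regular G' (with_one G' g' i)) x)"
      using sub by (auto simp: D_def spectrum_subset_iff)
    then show ?thesis
      by (rule invertible_operator_cong)
        (simp add: lin_comb_op_with_one(2)[OF G' _ ij] x_def G'.dihedral_pencil_def)
  qed
  define c where "c = csqrt (2 + z + inverse z)"
  have c: "c * c = 2 + z + inverse z" "(- c) * (- c) = 2 + z + inverse z"
    using power2_csqrt[of "2 + z + inverse z"] by (simp_all add: c_def power2_eq_square)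
  show False
    using G'.invertible_dihedral_pencilD[OF gi' inv(3,4) c(1) z0 main[OF c(1)] main[OF c(2)]]
      G'.not_invertible_left_regular_minus[OF G'.m_closed[OF gi'] z(1,2)] by blast
qed

section \<open>Homomorphisms from presented groups\<close>

lemma gwords_Nil: "[] \<in> gwords I"
  and gwords_Cons: "s # w \<in> gwords I \<longleftrightarrow> fst s \<in> I \<and> w \<in> gwords I"
  and gwords_append: "u @ v \<in> gwords I \<longleftrightarrow> u \<in> gwords I \<and> v \<in> gwords I"
  by (auto simp: gwords_def)

context group
begin

lemma word_eval_closed:
  assumes "g ` I \<subseteq> carrier G" "w \<in> gwords I"
  shows "word_eval G g w \<in> carrier G"
  using assms(2)
proof (induction w)
  case (Cons s w)
  then have "g (fst s) \<in> carrier G" using assms(1) by (auto simp: gwords_Cons)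
  then show ?case using Cons by (simp add: gwords_Cons)
qed simp

lemma word_eval_append:
  assumes "g ` I \<subseteq> carrier G" "u \<in> gwords I" "v \<in> gwords I"
  shows "word_eval G g (u @ v) = word_eval G g u \<otimes> word_eval G g v"
  using assms(2)
proof (induction u)
  case Nil
  then show ?case using word_eval_closed[OF assms(1,3)] by simp
next
  case (Cons s u)
  then have "g (fst s) \<in> carrier G" "u \<in> gwords I" using assms(1) by (auto simp: gwords_Cons)
  then show ?case
    using Cons word_eval_closed[OF assms(1)] assms(3) by (simp add: m_assoc)
qed

text \<open>Each generating move of \<open>pres_eq\<close> preserves the value once the relators
  hold; this makes the map out of a presented group well defined.\<close>

lemma word_eval_pres_eq:
  assumes g: "g ` I \<subseteq> carrier G"
    and R: "\<And>r. r \<in> R \<Longrightarrow> r \<in> gwords I \<Longrightarrow> word_eval G g r = \<one>"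
    and "pres_eq I R u v"
  shows "word_eval G g u = word_eval G g v"
  using assms(3)
proof induction
  case (cancel u v i b)
  have gi: "g i \<in> carrier G" using cancel g by auto
  have w: "[(i, b), (i, \<not> b)] \<in> gwords I" using cancel by (simp add: gwords_Cons gwords_Nil)
  have "word_eval G g [(i, b), (i, \<not> b)] = \<one>" using gi by (cases b) auto
  then show ?case
    unfolding word_eval_append[OF g cancel(1) gwords_append[THEN iffD2, OF conjI[OF w cancel(2)]]]
      word_eval_append[OF g w cancel(2)] word_eval_append[OF g cancel(1,2)]
    using word_eval_closed[OF g cancel(2)] by (simp del: word_eval.simps)
next
  case (relator u v r)
  then show ?case
    using R word_eval_closed[OF g] by (simp add: word_eval_append[OF g] gwords_append)
qed auto

lemma word_eval_surj:
  assumes g: "g ` I \<subseteq> carrier G" and x: "x \<in> generate G (g ` I)"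
  shows "\<exists>w\<in>gwords I. word_eval G g w = x"
  using x
proof induction
  case one
  then show ?case by (auto intro!: bexI[of _ "[]"] simp: gwords_Nil)
next
  case (incl h)
  then obtain i where "i \<in> I" "h = g i" by auto
  then show ?case using g
    by (intro bexI[of _ "[(i, True)]"]) (auto simp: gwords_Nil gwords_Cons)
next
  case (inv h)
  then obtain i where "i \<in> I" "h = g i" by auto
  then show ?case using g
    by (intro bexI[of _ "[(i, False)]"]) (auto simp: gwords_Nil gwords_Cons)
next
  case (eng x y)
  then obtain u v where "u \<in> gwords I" "word_eval G g u = x" "v \<in> gwords I" "word_eval G g v = y"
    by auto
  then show ?case using word_eval_append[OF g, of u v]
    by (intro bexI[of _ "u @ v"]) (auto simp: gwords_append)
qed

lemma word_eval_replicate_pair: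
  assumes "g i \<in> carrier G" "g j \<in> carrier G"
  shows "word_eval G g (concat (replicate k [(i, True), (j, True)])) = (g i \<otimes> g j) [^] k"
proof (induction k)
  case (Suc k)
  then have "word_eval G g (concat (replicate (Suc k) [(i, True), (j, True)]))
      = g i \<otimes> (g j \<otimes> (g i \<otimes> g j) [^] k)" by simp
  also have "\<dots> = (g i \<otimes> g j) [^] Suc k"
    unfolding nat_pow_Suc2[OF m_closed[OF assms]] using assms by (simp add: m_assoc)
  finally show ?case .
qed simp

end

text \<open>This is von Dyck's theorem. The map is read off a chosen word; two words for the same
  element are congruent under \<open>pres_eq\<close>, and congruent words have equal values in
  \<open>H\<close>.\<close>

lemma hom_from_presentation:
  assumes G: "presented_by G I g R" and H: "group H" "h ` I \<subseteq> carrier H"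
    and R: "\<And>r. r \<in> R \<Longrightarrow> r \<in> gwords I \<Longrightarrow> word_eval H h r = \<one>\<^bsub>H\<^esub>"
  shows "\<exists>f\<in>hom G H. \<forall>i\<in>I. f (g i) = h i"
proof -
  interpret G: group G using G by (simp add: presented_by_def)
  interpret H: group H by (fact H(1))
  have g: "g ` I \<subseteq> carrier G" and gen: "generate G (g ` I) = carrier G"
    using G by (auto simp: presented_by_def)
  define f where "f x = word_eval H h (SOME w. w \<in> gwords I \<and> word_eval G g w = x)" for x
  have f: "f (word_eval G g w) = word_eval H h w" if w: "w \<in> gwords I" for w
  proof -
    let ?w = "SOME u. u \<in> gwords I \<and> word_eval G g u = word_eval G g w"
    have "?w \<in> gwords I \<and> word_eval G g ?w = word_eval G g w"
      by (rule someI[of _ w]) (simp add: w)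
    then have "pres_eq I R ?w w" using w G by (auto simp: presented_by_def)
    then show ?thesis unfolding f_def using H.word_eval_pres_eq[OF H(2), of R] R by blast
  qed
  have "f \<in> hom G H"
  proof (rule homI)
    fix x assume "x \<in> carrier G"
    then obtain u where "u \<in> gwords I" "word_eval G g u = x"
      using G.word_eval_surj[OF g] gen by blast
    then show "f x \<in> carrier H" using f H.word_eval_closed[OF H(2)] by auto
    fix y assume "y \<in> carrier G"
    then obtain v where "v \<in> gwords I" "word_eval G g v = y"
      using G.word_eval_surj[OF g] gen by blast
    then show "f (x \<otimes>\<^bsub>G\<^esub> y) = f x \<otimes>\<^bsub>H\<^esub> f y"
      using f \<open>u \<in> gwords I\<close> \<open>word_eval G g u = x\<close>
      by (metis G.word_eval_append[OF g] H.word_eval_append[OF H(2)] gwords_append)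
  qed
  moreover have "f (g i) = h i" if "i \<in> I" for i
    using f[of "[(i, True)]"] that g H(2) by (auto simp: gwords_Cons gwords_Nil image_subset_iff)
  ultimately show ?thesis by blast
qed

lemma hom_surj_of_generators:
  assumes G: "group G" and G': "group G'" and f: "f \<in> hom G G'"
    and g: "g ` I \<subseteq> carrier G"
    and S: "S \<subseteq> insert \<one>\<^bsub>G'\<^esub> ((\<lambda>i. f (g i)) ` I)" and gen: "generate G' S = carrier G'"
  shows "f ` carrier G = carrier G'"
proof -
  interpret group_hom G G' f using assms by (simp add: group_hom_def group_hom_axioms_def)
  have "\<one>\<^bsub>G'\<^esub> \<in> f ` carrier G" using hom_one by (intro image_eqI[of _ _ "\<one>\<^bsub>G\<^esub>"]) auto
  moreover have "(\<lambda>i. f (g i)) ` I \<subseteq> f ` carrier G" using g by auto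
  ultimately have "S \<subseteq> f ` carrier G" using S by blast
  from H.generate_subgroup_incl[OF this img_is_subgroup] show ?thesis
    using gen by auto
qed

lemma hom_of_spectrum_subset:
  assumes cox: "coxeter_group G n g" and G': "group G'" and g': "g' ` {1..n} \<subseteq> carrier G'"
    and sub: "D G' n (with_one G' g') \<subseteq> D G n (with_one G g)"
  shows "\<exists>f\<in>hom G G'. \<forall>i\<in>{1..n}. f (g i) = g' i"
proof -
  obtain m where m: "coxeter_matrix n m" and pres: "presented_by G {1..n} g (coxeter_relators n m)"
    using cox by (auto simp: coxeter_group_def)
  then interpret G: group G by (simp add: presented_by_def)
  interpret G': group G' by (fact G')
  have g: "g ` {1..n} \<subseteq> carrier G" using pres by (simp add: presented_by_def)
  then have gc: "g i \<in> carrier G" if "i \<in> {1..n}" for i using that by auto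
  from g' have gc': "g' i \<in> carrier G'" if "i \<in> {1..n}" for i using that by auto
  \<comment> \<open>The relator is congruent to the empty word, hence trivial in \<open>G\<close>;
    an entry \<open>\<infinity>\<close> leaves nothing to transfer.\<close>
  have rel: "(g i \<otimes>\<^bsub>G\<^esub> g j) [^]\<^bsub>G\<^esub> k = \<one>\<^bsub>G\<^esub>"
    if "i \<in> {1..n}" "j \<in> {1..n}" "m i j = enat k" for i j k
  proof -
    let ?r = "concat (replicate k [(i, True), (j, True)])"
    have r: "?r \<in> coxeter_relators n m" using that by (auto simp: coxeter_relators_def)
    have w: "?r \<in> gwords {1..n}" using that by (auto simp: gwords_def)
    have "pres_eq {1..n} (coxeter_relators n m) ?r []"
      using pres_eq.relator[of "[]" "{1..n}" "[]", OF gwords_Nil gwords_Nil r w] by simp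
    then have "word_eval G g ?r = word_eval G g []"
      using pres w gwords_Nil unfolding presented_by_def by blast
    then show ?thesis using G.word_eval_replicate_pair gc that by simp
  qed
  have inv: "g i \<otimes>\<^bsub>G\<^esub> g i = \<one>\<^bsub>G\<^esub>" if "i \<in> {1..n}" for i
    using rel[of i i 1] that m gc by (simp add: coxeter_matrix_def one_enat_def)
  have inv': "g' i \<otimes>\<^bsub>G'\<^esub> g' i = \<one>\<^bsub>G'\<^esub>" if "i \<in> {1..n}" for i
    using involution_of_spectrum_subset[OF G.is_group G' g g' sub that inv[OF that]] .
  have rel': "(g' i \<otimes>\<^bsub>G'\<^esub> g' j) [^]\<^bsub>G'\<^esub> k = \<one>\<^bsub>G'\<^esub>"
    if ij: "i \<in> {1..n}" "j \<in> {1..n}" and k: "m i j = enat k" for i j k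
  \<comment> \<open>The pencil of two generators needs distinct coordinates; on the diagonal the
    product is already trivial.\<close>
  proof (cases "i = j")
    case True
    then show ?thesis using inv' ij by simp
  next
    case False
    then have "2 \<le> enat k" using m ij unfolding k[symmetric] by (simp add: coxeter_matrix_def)
    \<comment> \<open>The bound 2 rules out \<open>k = 0\<close>, as the choice of a separating root
      of unity requires.\<close>
    then have "0 < k" by (cases k) (simp_all add: numeral_eq_enat)
    then show ?thesis
      using product_order_of_spectrum_subset[OF G.is_group G' g g' sub ij False] inv inv' ij
        rel[OF ij k] by blast
  qed
  show ?thesis
  proof (rule hom_from_presentation[OF pres G' g'])
    fix r assume "r \<in> coxeter_relators n m"
    then obtain i j k where "r = concat (replicate k [(i, True), (j, True)])" "i \<in> {1..n}"
        "j \<in> {1..n}" "m i j = enat k"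
      by (auto simp: coxeter_relators_def)
    then show "word_eval G' g' r = \<one>\<^bsub>G'\<^esub>"
      using G'.word_eval_replicate_pair gc' rel' by simp
  qed
qed

section \<open>Evaluation of the spectrum polynomial\<close>

definition eval_monom :: "(nat \<Rightarrow> complex) \<Rightarrow> (nat \<Rightarrow>\<^sub>0 nat) \<Rightarrow> complex" where
  "eval_monom x m = (\<Prod>i\<in>Poly_Mapping.keys m. x i ^ Poly_Mapping.lookup m i)"

definition eval_cpoly :: "(nat \<Rightarrow> complex) \<Rightarrow> cpoly \<Rightarrow> complex" where
  "eval_cpoly x p = (\<Sum>m\<in>Poly_Mapping.keys p. Poly_Mapping.lookup p m * eval_monom x m)"

text \<open>Over a common finite superset of the keys two monomials multiply factor by factor; the
  added factors are \<open>x i ^ 0\<close>.\<close>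

lemma eval_monom_superset:
  assumes "finite S" "Poly_Mapping.keys m \<subseteq> S"
  shows "eval_monom x m = (\<Prod>i\<in>S. x i ^ Poly_Mapping.lookup m i)"
  unfolding eval_monom_def using assms
  by (intro prod.mono_neutral_left) (auto simp: in_keys_iff)

lemma eval_monom_add: "eval_monom x (m + m') = eval_monom x m * eval_monom x m'"
  using Poly_Mapping.keys_add[of m m']
  by (simp add: eval_monom_superset[of "Poly_Mapping.keys m \<union> Poly_Mapping.keys m'"]
      lookup_add power_add prod.distrib)

lemma eval_cpoly_superset:
  assumes "finite S" "Poly_Mapping.keys p \<subseteq> S"
  shows "eval_cpoly x p = (\<Sum>m\<in>S. Poly_Mapping.lookup p m * eval_monom x m)"
  unfolding eval_cpoly_def using assms
  by (intro sum.mono_neutral_left) (auto simp: in_keys_iff)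

lemma eval_cpoly_add: "eval_cpoly x (p + q) = eval_cpoly x p + eval_cpoly x q"
  using Poly_Mapping.keys_add[of p q]
  by (simp add: eval_cpoly_superset[of "Poly_Mapping.keys p \<union> Poly_Mapping.keys q"]
      lookup_add distrib_right sum.distrib)

lemma eval_cpoly_0: "eval_cpoly x 0 = 0"
  by (simp add: eval_cpoly_def)

lemma eval_cpoly_sum: "eval_cpoly x (\<Sum>a\<in>A. p a) = (\<Sum>a\<in>A. eval_cpoly x (p a))"
  by (induction A rule: infinite_finite_induct) (auto simp: eval_cpoly_add eval_cpoly_0)

lemma eval_cpoly_uminus: "eval_cpoly x (- p) = - eval_cpoly x p"
  using eval_cpoly_add[of x p "- p"] by (simp add: eval_cpoly_0 eq_neg_iff_add_eq_0 add.commute)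

lemma eval_cpoly_single: "eval_cpoly x (Poly_Mapping.single m c) = c * eval_monom x m"
  by (subst eval_cpoly_superset[of "{m}"]) (auto simp: lookup_single)

text \<open>Reduces multiplicativity of evaluation to single monomials, whose exponents add.\<close>

lemma cpoly_sum_monomials:
  "(p :: cpoly) = (\<Sum>m\<in>Poly_Mapping.keys p. Poly_Mapping.single m (Poly_Mapping.lookup p m))"
proof (rule poly_mapping_eqI)
  fix k
  have "Poly_Mapping.lookup p k
      = (\<Sum>m\<in>Poly_Mapping.keys p. if m = k then Poly_Mapping.lookup p m else 0)"
    by (simp add: sum.delta in_keys_iff)
  then show "Poly_Mapping.lookup p k = Poly_Mapping.lookup
      (\<Sum>m\<in>Poly_Mapping.keys p. Poly_Mapping.single m (Poly_Mapping.lookup p m)) k"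
    by (simp add: lookup_sum lookup_single when_def)
qed

lemma eval_cpoly_mult: "eval_cpoly x (p * q) = eval_cpoly x p * eval_cpoly x q"
proof -
  have "p * q = (\<Sum>m\<in>Poly_Mapping.keys p. \<Sum>m'\<in>Poly_Mapping.keys q.
      Poly_Mapping.single (m + m') (Poly_Mapping.lookup p m * Poly_Mapping.lookup q m'))"
    by (subst (1 2) cpoly_sum_monomials) (simp add: sum_product mult_single)
  then have "eval_cpoly x (p * q) = (\<Sum>m\<in>Poly_Mapping.keys p. \<Sum>m'\<in>Poly_Mapping.keys q.
      Poly_Mapping.lookup p m * Poly_Mapping.lookup q m' * (eval_monom x m * eval_monom x m'))"
    by (simp add: eval_cpoly_sum eval_cpoly_single eval_monom_add)
  also have "\<dots> = eval_cpoly x p * eval_cpoly x q"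
    unfolding eval_cpoly_def sum_product by (simp add: mult_ac)
  finally show ?thesis .
qed

lemma eval_cpoly_1: "eval_cpoly x 1 = 1"
  using eval_cpoly_single[of x 0 1] by (simp add: eval_monom_def)

lemma eval_cpoly_prod: "eval_cpoly x (\<Prod>a\<in>A. p a) = (\<Prod>a\<in>A. eval_cpoly x (p a))"
  by (induction A rule: infinite_finite_induct) (auto simp: eval_cpoly_mult eval_cpoly_1)

lemma eval_cpoly_const: "eval_cpoly x (poly_const c) = c"
  by (simp add: poly_const_def eval_cpoly_single eval_monom_def)

lemma eval_cpoly_var: "eval_cpoly x (poly_var i) = x i"
  by (simp add: poly_var_def eval_cpoly_single eval_monom_def)

lemma eval_cpoly_sign: "eval_cpoly x (of_int (sign p)) = of_int (sign p)"
  by (cases p rule: sign_cases) (simp_all add: eval_cpoly_1 eval_cpoly_uminus)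

lemma eval_cpoly_det_on: "eval_cpoly x (det_on I M) = det_on I (\<lambda>a b. eval_cpoly x (M a b))"
  by (simp add: det_on_def eval_cpoly_sum eval_cpoly_mult eval_cpoly_prod eval_cpoly_sign)

lemma eval_joint_spectrum_poly:
  "eval_cpoly x (joint_spectrum_poly I n A) = det_on I (\<lambda>a b. lin_comb_op n A x (basis_vec b) a)"
  unfolding joint_spectrum_poly_def eval_cpoly_det_on lin_comb_op_def
  by (simp add: eval_cpoly_sum eval_cpoly_mult eval_cpoly_const eval_cpoly_var mult.commute)

lemma det_on_diag:
  assumes "finite I"
  shows "det_on I (\<lambda>a b. if a = b then c else 0) = c ^ card I"
proof -
  \<comment> \<open>A permutation other than the identity moves some point and there picks an
    off-diagonal entry 0.\<close>
  have z: "(\<Prod>a\<in>I. if a = p a then c else 0) = 0" if "p permutes I" "p \<noteq> id" for p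
  proof -
    obtain a where a: "p a \<noteq> a" using \<open>p \<noteq> id\<close> by (auto simp: fun_eq_iff)
    then have "a \<in> I" using \<open>p permutes I\<close> permutes_not_in[of p I a] by blast
    then show ?thesis using a by (intro prod_zero[OF assms] bexI[of _ a]) auto
  qed
  have "det_on I (\<lambda>a b. if a = b then c else 0)
      = (\<Sum>p\<in>{id}. of_int (sign p) * (\<Prod>a\<in>I. if a = p a then c else 0))"
    unfolding det_on_def using assms z
    by (intro sum.mono_neutral_right) (auto simp: finite_permutations permutes_id)
  then show ?thesis by simp
qed

section \<open>Invertibility and determinants\<close>

text \<open>Conjugation by the enumeration \<open>e\<close> matches permutations of
  \<open>{0..<N}\<close> with those of \<open>I\<close> and preserves signs, so the two Leibniz sums
  agree term by term.\<close>

lemma det_on_eq_det: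
  assumes e: "bij_betw e {0..<N} I"
  shows "det_on I M = det (mat N N (\<lambda>(i, j). M (e i) (e j)))"
proof -
  let ?A = "{0..<N}"
  let ?d = "inv_into ?A e"
  have d: "bij_betw ?d I ?A" using bij_betw_inv_into[OF e] .
  have ed: "e (?d a) = a" if "a \<in> I" for a using bij_betw_inv_into_right[OF e that] .
  have de: "?d (e i) = i" if "i \<in> ?A" for i using bij_betw_inv_into_left[OF e that] .
  have ap: "map_permutation ?A e p (e i) = e (p i)" if "i \<in> ?A" for i p
    using that e de by (auto simp: map_permutation_def restrict_id_def bij_betw_def)
  have "det (mat N N (\<lambda>(i, j). M (e i) (e j)))
      = (\<Sum>p\<in>{p. p permutes ?A}. of_int (sign p) * (\<Prod>i\<in>?A. M (e i) (e (p i))))"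
    unfolding det_def by (auto intro!: sum.cong prod.cong simp: permutes_in_image)
  also have "\<dots> = det_on I M"
    unfolding det_on_def
  proof (rule sum.reindex_bij_witness[where i = "map_permutation I ?d"
        and j = "map_permutation ?A e"], goal_cases)
    case (1 p)
    then show ?case using map_permutation_compose_inv[OF e _ de] by simp
  next
    case (2 p)
    then show ?case using map_permutation_permutes[OF e] by simp
  next
    case (3 p)
    then show ?case using map_permutation_compose_inv[OF d _ ed] by simp
  next
    case (4 p)
    then show ?case using map_permutation_permutes[OF d] by simp
  next
    case (5 p)
    have "(\<Prod>a\<in>I. M a (map_permutation ?A e p a)) = (\<Prod>i\<in>?A. M (e i) (e (p i)))"
      using prod.reindex_bij_betw[OF e, of "\<lambda>a. M a (map_permutation ?A e p a)", symmetric] ap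
      by simp
    then show ?case
      using 5 e by (simp add: sign_map_permutation bij_betw_def)
  qed
  finally show ?thesis by simp
qed

section \<open>Operators over a finite index set as matrices\<close>

lemma operator_expansion:
  assumes A: "bounded_operator I A" and fin: "finite I" and v: "v \<in> ell2 I"
  shows "A v = (\<lambda>x. \<Sum>b\<in>I. v b * A (basis_vec b) x)"
proof -
  \<comment> \<open>Linearity is available only on \<open>ell2 I\<close>, so membership is carried
    along in the induction.\<close>
  have *: "(\<lambda>x. \<Sum>b\<in>F. v b * basis_vec b x) \<in> ell2 I \<and>
      A (\<lambda>x. \<Sum>b\<in>F. v b * basis_vec b x) = (\<lambda>x. \<Sum>b\<in>F. v b * A (basis_vec b) x)"
    if "finite F" "F \<subseteq> I" for F
    using that
  proof (induction F rule: finite_induct)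
    case empty
    have z: "(\<lambda>x. 0) \<in> ell2 I" by (simp add: ell2_def)
    then show ?case using bounded_operatorD(3)[OF A z, of 0] by simp
  next
    case (insert b F)
    have b: "basis_vec b \<in> ell2 I" using insert by (simp add: basis_vec_ell2)
    note bc = ell2_cmult(1)[OF b, of "v b"]
    show ?case
      using insert bounded_operatorD(2)[OF A bc] bounded_operatorD(3)[OF A b, of "v b"]
        ell2_add[OF bc] by simp
  qed
  have "(\<lambda>x. \<Sum>b\<in>I. v b * basis_vec b x) = v"
  proof
    fix x
    have "(\<Sum>b\<in>I. v b * basis_vec b x) = (\<Sum>b\<in>I. if b = x then v b else 0)"
      by (intro sum.cong) (auto simp: basis_vec_def)
    then show "(\<Sum>b\<in>I. v b * basis_vec b x) = v x"
      using fin v by (auto simp: sum.delta ell2_def)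
  qed
  then show ?thesis using *[OF fin] by simp
qed

text \<open>Invertibility asks for a bounded inverse, and that inverse will come from a matrix. The
  sum of the absolute values of all entries is a bound.\<close>

lemma bounded_operator_matrix:
  fixes N :: "'a \<Rightarrow> 'a \<Rightarrow> complex"
  assumes fin: "finite I"
  shows "bounded_operator I (\<lambda>v a. if a \<in> I then \<Sum>b\<in>I. N a b * v b else 0)"
proof -
  let ?B = "\<lambda>v a. if a \<in> I then \<Sum>b\<in>I. N a b * v b else 0"
  define K where "K a = (\<Sum>b\<in>I. cmod (N a b))" for a
  have K: "0 \<le> K a" for a by (simp add: K_def sum_nonneg)
  have bound: "ell2_norm I (?B v) \<le> (\<Sum>a\<in>I. K a) * ell2_norm I v" if v: "v \<in> ell2 I" for v
  proof (rule ell2_bounded_sums(2))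
    show "0 \<le> (\<Sum>a\<in>I. K a) * ell2_norm I v" by (simp add: K sum_nonneg ell2_norm_nonneg)
    fix F assume F: "finite F" "F \<subseteq> I"
    have vb: "cmod (v b) \<le> ell2_norm I v" if "b \<in> I" for b
      using ell2_finite_sum_le[OF v, of "{b}"] that ell2_norm_nonneg[of I v]
      by (auto intro: power2_le_imp_le)
    have "cmod (?B v a) \<le> K a * ell2_norm I v" if "a \<in> I" for a
    proof -
      have "cmod (\<Sum>b\<in>I. N a b * v b) \<le> (\<Sum>b\<in>I. cmod (N a b) * ell2_norm I v)"
        by (intro order.trans[OF norm_sum] sum_mono) (simp add: norm_mult mult_left_mono vb)
      then show ?thesis using that by (simp add: K_def sum_distrib_right)
    qed
    then have "(\<Sum>a\<in>F. (cmod (?B v a))\<^sup>2) \<le> (\<Sum>a\<in>F. (K a * ell2_norm I v)\<^sup>2)"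
      using F by (intro sum_mono power_mono) auto
    also have "\<dots> = (\<Sum>a\<in>F. (K a)\<^sup>2) * (ell2_norm I v)\<^sup>2"
      by (simp add: power_mult_distrib sum_distrib_right)
    also have "\<dots> \<le> (\<Sum>a\<in>I. (K a)\<^sup>2) * (ell2_norm I v)\<^sup>2"
      using F fin by (intro mult_right_mono sum_mono2) auto
    also have "\<dots> \<le> (\<Sum>a\<in>I. K a)\<^sup>2 * (ell2_norm I v)\<^sup>2"
    proof (intro mult_right_mono)
      have "K a \<le> (\<Sum>a\<in>I. K a)" if "a \<in> I" for a
        using that fin K by (intro member_le_sum) auto
      then have "(\<Sum>a\<in>I. K a * K a) \<le> (\<Sum>a\<in>I. K a * (\<Sum>a\<in>I. K a))"
        using K by (intro sum_mono mult_left_mono) auto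
      then show "(\<Sum>a\<in>I. (K a)\<^sup>2) \<le> (\<Sum>a\<in>I. K a)\<^sup>2"
        by (simp add: power2_eq_square sum_distrib_right)
    qed simp
    finally show "(\<Sum>a\<in>F. (cmod (?B v a))\<^sup>2) \<le> ((\<Sum>a\<in>I. K a) * ell2_norm I v)\<^sup>2"
      by (simp add: power_mult_distrib)
  qed simp
  show ?thesis
    by (rule bounded_operatorI[OF _ _ _ bound])
      (auto simp: ell2_iff_finite[OF fin] fun_eq_iff algebra_simps sum.distrib sum_distrib_left)
qed

text \<open>A vanishing determinant gives a kernel vector, against injectivity; a nonzero one gives
  an inverse matrix, which is read back as a bounded operator.\<close>

lemma invertible_operator_iff_det:
  assumes A: "bounded_operator I A" and fin: "finite I"
  shows "invertible_operator I A \<longleftrightarrow> det_on I (\<lambda>a b. A (basis_vec b) a) \<noteq> 0"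
proof -
  obtain e where e: "bij_betw e {0..<card I} I" using ex_bij_betw_nat_finite[OF fin] by blast
  define d where "d = inv_into {0..<card I} e"
  define N where "N = card I"
  note e = e[folded N_def]
  have ed: "e (d a) = a" "d a < N" if "a \<in> I" for a
    using bij_betw_inv_into_right[OF e] bij_betw_apply[OF bij_betw_inv_into[OF e]] that
    by (auto simp: d_def N_def)
  have de: "d (e i) = i" "e i \<in> I" if "i < N" for i
    using bij_betw_inv_into_left[OF e] bij_betw_apply[OF e] that by (auto simp: d_def N_def)
  define M where "M = mat N N (\<lambda>(i, j). A (basis_vec (e j)) (e i))"
  have M: "M \<in> carrier_mat N N" by (simp add: M_def)
  have detM: "det_on I (\<lambda>a b. A (basis_vec b) a) = det M"
    unfolding M_def by (rule det_on_eq_det[OF e])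
  have Av: "A v = (\<lambda>x. \<Sum>j<N. v (e j) * A (basis_vec (e j)) x)" if "v \<in> ell2 I" for v
    unfolding operator_expansion[OF A fin that]
    by (intro ext sum.reindex_bij_betw[OF e[unfolded atLeast0LessThan], symmetric])
  \<comment> \<open>A column \<open>w\<close> stands for the function with value
    \<open>w $ d a\<close> at \<open>a\<close> in \<open>I\<close> and 0 elsewhere.\<close>
  have MV: "M *\<^sub>v w = vec N (\<lambda>i. A (\<lambda>a. if a \<in> I then w $ d a else 0) (e i))"
    if "w \<in> carrier_vec N" for w
  proof -
    have "(\<lambda>a. if a \<in> I then w $ d a else 0) \<in> ell2 I" by (simp add: ell2_iff_finite fin)
    from Av[OF this] show ?thesis using that de
      by (intro eq_vecI) (auto simp: M_def scalar_prod_def atLeast0LessThan mult.commute)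
  qed
  show ?thesis unfolding detM
  proof
    assume inv: "invertible_operator I A"
    show "det M \<noteq> 0"
    proof
      assume "det M = 0"
      then obtain w where w: "w \<in> carrier_vec N" "w \<noteq> 0\<^sub>v N" "M *\<^sub>v w = 0\<^sub>v N"
        using det_0_iff_vec_prod_zero[OF M] by blast
      let ?v = "\<lambda>a. if a \<in> I then w $ d a else 0"
      have v: "?v \<in> ell2 I" by (simp add: ell2_iff_finite fin)
      have "A ?v a = 0" for a
      proof (cases "a \<in> I")
        case True
        then show ?thesis
          using arg_cong[OF w(3), of "\<lambda>u. u $ d a"] ed[OF True] unfolding MV[OF w(1)] by simp
      next
        case False
        then show ?thesis using bounded_operatorD(1)[OF A v] by (simp add: ell2_def)
      qed
      then have "?v = (\<lambda>a. 0)"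
        using invertible_operator_left_cancel[OF inv v] by blast
      then have "w $ i = 0" if "i < N" for i using fun_cong[of ?v _ "e i"] de[OF that] by simp
      then have "w = 0\<^sub>v N" using w(1) by (intro eq_vecI) auto
      then show False using w(2) by simp
    qed
  next
    assume "det M \<noteq> 0"
    from det_non_zero_imp_unit[OF M this, where b = "()"]
    obtain L where L: "L \<in> carrier_mat N N" "L * M = 1\<^sub>m N" "M * L = 1\<^sub>m N"
      by (auto simp: Units_def ring_mat_def)
    define B where "B v a = (if a \<in> I then \<Sum>b\<in>I. L $$ (d a, d b) * v b else 0)"
      for v :: "'a \<Rightarrow> complex" and a
    have B: "bounded_operator I B" unfolding B_def by (rule bounded_operator_matrix[OF fin])
    \<comment> \<open>\<open>V\<close> takes coordinate columns. It turns \<open>A\<close> and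
      \<open>B\<close> into multiplication by \<open>M\<close> and \<open>L\<close> and is injective
      on \<open>ell2 I\<close>, so the inverse laws can be checked on columns.\<close>
    define V where "V v = vec N (\<lambda>i. v (e i))" for v :: "'a \<Rightarrow> complex"
    have V: "V v \<in> carrier_vec N" for v by (simp add: V_def)
    have VA: "V (A v) = M *\<^sub>v V v" if "v \<in> ell2 I" for v
      using Av[OF that]
      by (intro eq_vecI) (auto simp: V_def M_def scalar_prod_def atLeast0LessThan mult.commute)
    have "(\<Sum>b\<in>I. L $$ (i, d b) * v b) = (\<Sum>j<N. L $$ (i, j) * v (e j))" for i v
      unfolding sum.reindex_bij_betw[OF e, symmetric] by (intro sum.cong) (auto simp: de)
    then have VB: "V (B v) = L *\<^sub>v V v" for v
      using L(1) de
      by (intro eq_vecI) (auto simp: V_def B_def scalar_prod_def atLeast0LessThan)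
    have inj: "u = v" if "u \<in> ell2 I" "v \<in> ell2 I" "V u = V v" for u v
    proof
      fix a
      show "u a = v a"
      proof (cases "a \<in> I")
        case True
        then show ?thesis
          using arg_cong[OF that(3), of "\<lambda>w. w $ d a"] ed[OF True] by (simp add: V_def)
      qed (use that in \<open>simp add: ell2_def\<close>)
    qed
    have "A (B v) = v \<and> B (A v) = v" if v: "v \<in> ell2 I" for v
    proof
      note cl = bounded_operatorD(1)[OF A] bounded_operatorD(1)[OF B]
      have "V (A (B v)) = M *\<^sub>v (L *\<^sub>v V v)" using VA VB cl v by simp
      also have "\<dots> = V v" using L M V by (simp flip: assoc_mult_mat_vec)
      finally show "A (B v) = v" using inj cl v by blast
      have "V (B (A v)) = L *\<^sub>v (M *\<^sub>v V v)" using VA VB cl v by simp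
      also have "\<dots> = V v" using L M V by (simp flip: assoc_mult_mat_vec)
      finally show "B (A v) = v" using inj cl v by blast
    qed
    then show "invertible_operator I A" using A B by (auto simp: invertible_operator_def)
  qed
qed

section \<open>The regular pencil and its polynomial\<close>

lemma bounded_pencil:
  assumes "group G" "g ` {1..n} \<subseteq> carrier G"
  shows "bounded_operator (carrier G) (lin_comb_op n (\<lambda>i. left_regular G (with_one G g i)) x)"
proof -
  interpret group G by fact
  have "with_one G g i \<in> carrier G" if "i \<le> n" for i
    using that assms(2) by (auto simp: with_one_def)
  then show ?thesis
    by (intro bounded_operator_lin_comb_op bounded_operator_left_regular is_group)
qed

lemma invertible_pencil_iff_eval:
  assumes "group G" "g ` {1..n} \<subseteq> carrier G" "finite (carrier G)"
  shows "invertible_operator (carrier G) (lin_comb_op n (\<lambda>i. left_regular G (with_one G g i)) x)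
    \<longleftrightarrow> eval_cpoly x (D_poly G n (with_one G g)) \<noteq> 0"
  unfolding D_poly_def eval_joint_spectrum_poly
  by (rule invertible_operator_iff_det[OF bounded_pencil[OF assms(1,2)] assms(3)])

text \<open>For finite groups \<open>D\<close> is the zero set of \<open>D_poly\<close>, and a
  nonzero scalar factor does not change zeros.\<close>

lemma spectrum_subset_of_subscheme_eq:
  assumes "group G" "g ` {1..n} \<subseteq> carrier G" "group G'" "g' ` {1..n} \<subseteq> carrier G'"
    and "D_eq_as_subschemes G (with_one G g) G' (with_one G' g') n"
  shows "D G' n (with_one G' g') \<subseteq> D G n (with_one G g)"
  using assms
  by (auto simp: D_eq_as_subschemes_def D_def spectrum_subset_iff invertible_pencil_iff_eval
      eval_cpoly_mult eval_cpoly_const)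

text \<open>With all coordinates but the 0-th equal to 0 the pencil is the scalar \<open>c\<close>;
  the exponent is the dimension, so the polynomial determines the group order.\<close>

lemma eval_D_poly_at_identity:
  assumes "group G" "finite (carrier G)"
  shows "eval_cpoly (\<lambda>i. if i = 0 then c else 0) (D_poly G n (with_one G g)) = c ^ card (carrier G)"
proof -
  interpret group G by fact
  have "lin_comb_op n (\<lambda>i. left_regular G (with_one G g i)) (\<lambda>i. if i = 0 then c else 0)
      (basis_vec b) a = (if a = b then c else 0)" if "a \<in> carrier G" for a b
  proof -
    have "lin_comb_op n (\<lambda>i. left_regular G (with_one G g i)) (\<lambda>i. if i = 0 then c else 0)
        (basis_vec b) a
      = (\<Sum>i\<in>{0}. (if i = 0 then c else 0) * left_regular G (with_one G g i) (basis_vec b) a)"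
      unfolding lin_comb_op_def by (intro sum.mono_neutral_right) auto
    then show ?thesis using that by (simp add: with_one_def left_regular_def basis_vec_def)
  qed
  then have "det_on (carrier G) (\<lambda>a b. lin_comb_op n (\<lambda>i. left_regular G (with_one G g i))
      (\<lambda>i. if i = 0 then c else 0) (basis_vec b) a)
    = det_on (carrier G) (\<lambda>a b. if a = b then c else 0)"
    unfolding det_on_def by (intro sum.cong prod.cong arg_cong2[of _ _ _ _ "(*)"]) auto
  then show ?thesis
    unfolding D_poly_def eval_joint_spectrum_poly using det_on_diag[OF assms(2)] by simp
qed

lemma card_eq_of_subscheme_eq:
  assumes "group G" "group G'" "D_eq_as_subschemes G (with_one G g) G' (with_one G' g') n"
  shows "card (carrier G) = card (carrier G')"
proof -
  obtain c where fin: "finite (carrier G)" "finite (carrier G')"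
    and c: "D_poly G' n (with_one G' g') = poly_const c * D_poly G n (with_one G g)"
    using assms(3) by (auto simp: D_eq_as_subschemes_def)
  have "t ^ card (carrier G') = c * t ^ card (carrier G)" for t
    using arg_cong[OF c, of "eval_cpoly (\<lambda>i. if i = 0 then t else 0)"] assms fin
    by (simp add: eval_D_poly_at_identity eval_cpoly_mult eval_cpoly_const)
  \<comment> \<open>\<open>t = 1\<close> forces the scalar to be 1; then \<open>t = 2\<close>
    compares two powers of 2, whose exponents must agree.\<close>
  from this[of 1] this[of 2] have "(2::complex) ^ card (carrier G') = 2 ^ card (carrier G)" by simp
  then have "(of_nat (2 ^ card (carrier G')) :: complex) = of_nat (2 ^ card (carrier G))" by simp
  then show ?thesis unfolding of_nat_eq_iff by simp
qed

theorem theorem1p1: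
  fixes G :: "('a, 'c) monoid_scheme" and G' :: "('b, 'd) monoid_scheme"
    and n :: nat and g :: "nat \<Rightarrow> 'a" and g' :: "nat \<Rightarrow> 'b"
  assumes coxeter: "coxeter_group G n g"
    and group': "group G'"
    and gens': "g' ` {1..n} \<subseteq> carrier G'"
      "generate G' (with_one G' g' ` {0..n}) = carrier G'"
  shows "(D G' n (with_one G' g') \<subseteq> D G n (with_one G g) \<longrightarrow>
           (\<exists>f\<in>epi G G'. \<forall>i\<in>{1..n}. f (g i) = g' i) \<and>
           (finite (carrier G) \<longrightarrow> finite (carrier G'))) \<and>
         (finite (carrier G) \<and>
           D_eq_as_subschemes G (with_one G g) G' (with_one G' g') n \<longrightarrow>
           (\<exists>f\<in>epi G G'. \<forall>i\<in>{1..n}. f (g i) = g' i) \<and>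
           (\<forall>f\<in>hom G G'. (\<forall>i\<in>{1..n}. f (g i) = g' i) \<longrightarrow> f \<in> iso G G'))"
proof -
  have G: "group G" and g: "g ` {1..n} \<subseteq> carrier G"
    using coxeter by (auto simp: coxeter_group_def presented_by_def)
  \<comment> \<open>Stated for every \<open>f\<close> with the prescribed values, so that it serves
    both the epimorphism and the isomorphism claim.\<close>
  have surj: "f ` carrier G = carrier G'"
    if f: "f \<in> hom G G'" "\<forall>i\<in>{1..n}. f (g i) = g' i" for f
  proof (rule hom_surj_of_generators[OF G group' f(1) g _ gens'(2)])
    show "with_one G' g' ` {0..n} \<subseteq> insert \<one>\<^bsub>G'\<^esub> ((\<lambda>i. f (g i)) ` {1..n})"
      using f(2) by (auto simp: with_one_def)
  qed
  have epi: "\<exists>f\<in>epi G G'. \<forall>i\<in>{1..n}. f (g i) = g' i"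
    if sub: "D G' n (with_one G' g') \<subseteq> D G n (with_one G g)"
    using hom_of_spectrum_subset[OF coxeter group' gens'(1) sub] surj by (auto simp: epi_def)
  have fin: "finite (carrier G')"
    if "\<exists>f\<in>epi G G'. \<forall>i\<in>{1..n}. f (g i) = g' i" "finite (carrier G)"
    using that by (auto simp: epi_def) (metis finite_imageI)
  have iso: "f \<in> iso G G'"
    if eq: "D_eq_as_subschemes G (with_one G g) G' (with_one G' g') n"
      and f: "f \<in> hom G G'" "\<forall>i\<in>{1..n}. f (g i) = g' i" for f
  proof -
    have "finite (carrier G)" using eq by (simp add: D_eq_as_subschemes_def)
    then have "inj_on f (carrier G)"
      using card_eq_of_subscheme_eq[OF G group' eq] surj[OF f] by (simp add: eq_card_imp_inj_on)
    then show ?thesis using f surj[OF f] by (simp add: iso_def bij_betw_def)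
  qed
  \<comment> \<open>Equality as subschemes implies the inclusion of point sets, so the second claim
    takes its epimorphism from the first.\<close>
  show ?thesis
    using epi fin iso spectrum_subset_of_subscheme_eq[OF G g group' gens'(1)]
    by (intro conjI impI ballI) simp_all
qed

end
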